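(* Let $V$ be a finite nonempty set and let $P_V$ be the set of coloured graphs with vertex set $V$ whose graph colouring is vertex regular. Let $\mathcal{S}^{+}_{P_V}=\{\mathcal{S}^{+}(\mathcal{V},\mathcal{E}) : (\mathcal{V},\mathcal{E})\in P_V\}$ and $\mathcal{R}^{+}_{P_V}=\{\mathcal{R}^{+}(\mathcal{V},\mathcal{E}) : (\mathcal{V},\mathcal{E})\in P_V\}$ be the corresponding sets of RCON and RCOR models. Then $\mathcal{S}^{+}_{P_V}$ and $\mathcal{R}^{+}_{P_V}$, each ordered by model inclusion (set inclusion), are complete lattices. Their meet operation is induced by the meet operation of $\langle\mathcal{C}_V;\preceq\rangle$: for $\mathcal{G},\mathcal{H}\in P_V$, the meet of the models (of the given type) represented by $\mathcal{G}$ and $\mathcal{H}$ is the model represented by $\mathcal{G}\wedge\mathcal{H}$ (which lies in $P_V$). The join of the two models represented by $\mathcal{G},\mathcal{H}\in P_V$ is the model represented by $s_{P}(\mathcal{G}\vee\mathcal{H})$.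
   Context: Graphs are undirected and simple. A coloured graph with vertex set $V$ is a pair $\mathcal{G}=(\mathcal{V},\mathcal{E})$ where $\mathcal{V}$ is a partition of $V$ (vertex colour classes) and $\mathcal{E}$ is a partition of the edge set $E$ of some graph $G=(V,E)$ (edge colour classes); $G$ is the underlying uncoloured graph. $\mathcal{C}_V$ is the set of all coloured graphs with vertex set $V$. For partitions $P_1,P_2$ of the same set, $P_1\le P_2$ means $P_1$ is finer than $P_2$ (every set in $P_2$ is a union of sets in $P_1$); $\wedge,\vee$ for partitions are the infimum and supremum for this order. Partial order on $\mathcal{C}_V$: for $\mathcal{G}=(\mathcal{V}_{\mathcal{G}},\mathcal{E}_{\mathcal{G}})$ and $\mathcal{H}=(\mathcal{V}_{\mathcal{H}},\mathcal{E}_{\mathcal{H}})$ with edge sets $E_{\mathcal{G}},E_{\mathcal{H}}$, $\mathcal{G}\preceq\mathcal{H}$ iff (i) $E_{\mathcal{G}}\subseteq E_{\mathcal{H}}$, (ii) $\mathcal{V}_{\mathcal{G}}\ge\mathcal{V}_{\mathcal{H}}$, (iii) every class in $\mathcal{E}_{\mathcal{G}}$ is a union of classes in $\mathcal{E}_{\mathcal{H}}$. $\langle\mathcal{C}_V;\preceq\rangle$ is a complete lattice with $$\mathcal{G}\wedge\mathcal{H}=(\mathcal{V}_{\mathcal{G}}\vee\mathcal{V}_{\mathcal{H}},\ \mathcal{E}^{*}_{\mathcal{G}}\vee\mathcal{E}^{*}_{\mathcal{H}}),\qquad \mathcal{G}\vee\mathcal{H}=(\mathcal{V}_{\mathcal{G}}\wedge\mathcal{V}_{\mathcal{H}},\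 \mathcal{E}^{**}_{\mathcal{G}}\wedge\mathcal{E}^{**}_{\mathcal{H}}),$$ where $\mathcal{E}^{*}_{\mathcal{G}}\subseteq\mathcal{E}_{\mathcal{G}}$ and $\mathcal{E}^{*}_{\mathcal{H}}\subseteq\mathcal{E}_{\mathcal{H}}$ are maximal with the property that they are partitions of the same subset of $E_{\mathcal{G}}\cap E_{\mathcal{H}}$, $\mathcal{E}^{**}_{\mathcal{G}}=\mathcal{E}_{\mathcal{G}}\cup\{E_{\mathcal{H}}\setminus E_{\mathcal{G}}\}$ and $\mathcal{E}^{**}_{\mathcal{H}}=\mathcal{E}_{\mathcal{H}}\cup\{E_{\mathcal{G}}\setminus E_{\mathcal{H}}\}$ (empty sets omitted). For $(\mathcal{V},\mathcal{E})\in\mathcal{C}_V$, models are identified with sets of symmetric positive definite real matrices $K=(k_{\alpha\beta})_{\alpha,\beta\in V}$. The RCON model $\mathcal{S}^{+}(\mathcal{V},\mathcal{E})$ consists of those $K$ with $k_{\alpha\beta}=0$ for $\alpha\ne\beta$ with $\alpha\beta\notin E$, $k_{\alpha\alpha}=k_{\beta\beta}$ whenever $\alpha,\beta$ lie in the same class of $\mathcal{V}$, and $k_{\alpha\beta}=k_{\gamma\delta}$ whenever edges $\alpha\beta,\gamma\delta$ lie in the same class of $\mathcal{E}$. The RCOR model $\mathcal{R}^{+}(\mathcal{V},\mathcal{E})$ is defined in the same way except that the last condition is replaced by $c_{\alpha\beta}=c_{\gamma\delta}$ whenever edges $\alpha\beta,\gamma\delta$ lie in the same class of $\mathcal{E}$,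 where $c_{\alpha\beta}=k_{\alpha\beta}/\sqrt{k_{\alpha\alpha}k_{\beta\beta}}$. A partition $P$ of the vertex set of a graph $H$ is equitable with respect to $H$ if for all $v,w\in P$ and all $\alpha,\beta\in v$, $|\mathrm{ne}(\alpha)\cap w|=|\mathrm{ne}(\beta)\cap w|$, where $\mathrm{ne}$ denotes the set of neighbours in $H$. $(\mathcal{V},\mathcal{E})$ is vertex regular if $\mathcal{V}$ is equitable with respect to $G^{u}=(V,u)$ for every $u\in\mathcal{E}$. For every finite graph $H$ and partition $P$ of its vertex set there is a unique coarsest partition finer than $P$ and equitable with respect to $H$ (a known fact), denoted $r_H(P)$. The coloured factor graph of $\mathcal{G}=(\mathcal{V},\mathcal{E})\in\mathcal{C}_V$ is $(\mathcal{V}\cup\mathcal{N},E_F)$: $N$ is a set of nodes, disjoint from $V$, one node for each edge in $E$; $\mathcal{N}$ is the partition of $N$ corresponding to $\mathcal{E}$; and $E_F=\{\alpha n: \alpha\in V,\ n\in N \text{ represents an edge incident with }\alpha\}$. Put $G_F=(V\cup N,E_F)$. The partition $r_{G_F}(\mathcal{V}\cup\mathcal{N})$ consists of a partition $\mathcal{V}_R$ of $V$ and a partition of $N$, the latter corresponding to a partition $\mathcal{E}_R$ of $E$; set $s_R(\mathcal{G})=(\mathcal{V}_R,\mathcal{E}_R)$ and $s_P(\mathcal{G})=(\mathcal{V}_R,\mathcal{E})$. *)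

theory Defs
  imports
    "HOL-Analysis.Analysis"
    "HOL-Library.Disjoint_Sets"
    "HOL-Algebra.Complete_Lattice"
begin

text \<open>The vertex set \<open>V\<close> is the universe of a type \<open>'v\<close> of class \<open>finite\<close>, so that concentration
  matrices have type \<open>real^'v^'v\<close>. An edge is a two-element set of vertices. A coloured graph is the
  pair of its vertex colour classes and its edge colour classes; its edge set is the union
  of the edge colour classes.\<close>

type_synonym 'v cgraph = "'v set set \<times> 'v set set set"

abbreviation vclasses :: "'v cgraph \<Rightarrow> 'v set set"
  where "vclasses \<equiv> fst"

abbreviation eclasses :: "'v cgraph \<Rightarrow> 'v set set set"
  where "eclasses \<equiv> snd"

definition edges :: "'v cgraph \<Rightarrow> 'v set set"
  where "edges G = \<Union> (eclasses G)"

definition coloured_graphs :: "'v::finite cgraph set"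
  where "coloured_graphs =
    {G. partition_on UNIV (vclasses G) \<and>
        (\<exists>E \<subseteq> {e. card e = 2}. partition_on E (eclasses G))}"

definition cgraph_le :: "'v cgraph \<Rightarrow> 'v cgraph \<Rightarrow> bool"
  where "cgraph_le G H \<longleftrightarrow>
    edges G \<subseteq> edges H \<and>
    refines UNIV (vclasses H) (vclasses G) \<and>
    (\<forall>u \<in> eclasses G. \<exists>U \<subseteq> eclasses H. u = \<Union> U)"

definition cgraph_order :: "'v::finite cgraph gorder"
  where "cgraph_order = \<lparr>carrier = coloured_graphs, eq = (=), le = cgraph_le\<rparr>"

definition inclusion_order :: "'a set set \<Rightarrow> 'a set gorder"
  where "inclusion_order M = \<lparr>carrier = M, eq = (=), le = (\<subseteq>)\<rparr>"


definition spd_matrices :: "(real^'v^'v::finite) set"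
  where "spd_matrices = {K. transpose K = K \<and> (\<forall>x. x \<noteq> 0 \<longrightarrow> x \<bullet> (K *v x) > 0)}"

definition RCON :: "'v::finite cgraph \<Rightarrow> (real^'v^'v) set"
  where "RCON G = {K \<in> spd_matrices.
    (\<forall>\<alpha> \<beta>. \<alpha> \<noteq> \<beta> \<and> {\<alpha>, \<beta>} \<notin> edges G \<longrightarrow> K $ \<alpha> $ \<beta> = 0) \<and>
    (\<forall>v \<in> vclasses G. \<forall>\<alpha> \<in> v. \<forall>\<beta> \<in> v. K $ \<alpha> $ \<alpha> = K $ \<beta> $ \<beta>) \<and>
    (\<forall>u \<in> eclasses G. \<forall>\<alpha> \<beta> \<gamma> \<delta>. {\<alpha>, \<beta>} \<in> u \<and> {\<gamma>, \<delta>} \<in> u \<longrightarrow>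
      K $ \<alpha> $ \<beta> = K $ \<gamma> $ \<delta>)}"

definition scaled_entry :: "real^'v^'v::finite \<Rightarrow> 'v \<Rightarrow> 'v \<Rightarrow> real"
  where "scaled_entry K \<alpha> \<beta> = K $ \<alpha> $ \<beta> / sqrt (K $ \<alpha> $ \<alpha> * K $ \<beta> $ \<beta>)"

definition RCOR :: "'v::finite cgraph \<Rightarrow> (real^'v^'v) set"
  where "RCOR G = {K \<in> spd_matrices.
    (\<forall>\<alpha> \<beta>. \<alpha> \<noteq> \<beta> \<and> {\<alpha>, \<beta>} \<notin> edges G \<longrightarrow> K $ \<alpha> $ \<beta> = 0) \<and>
    (\<forall>v \<in> vclasses G. \<forall>\<alpha> \<in> v. \<forall>\<beta> \<in> v. K $ \<alpha> $ \<alpha> = K $ \<beta> $ \<beta>) \<and>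
    (\<forall>u \<in> eclasses G. \<forall>\<alpha> \<beta> \<gamma> \<delta>. {\<alpha>, \<beta>} \<in> u \<and> {\<gamma>, \<delta>} \<in> u \<longrightarrow>
      scaled_entry K \<alpha> \<beta> = scaled_entry K \<gamma> \<delta>)}"


definition neighbours :: "'a set set \<Rightarrow> 'a \<Rightarrow> 'a set"
  where "neighbours E \<alpha> = {\<beta>. {\<alpha>, \<beta>} \<in> E}"

definition equitable :: "'a set set \<Rightarrow> 'a set set \<Rightarrow> bool"
  where "equitable E P \<longleftrightarrow>
    (\<forall>v \<in> P. \<forall>w \<in> P. \<forall>\<alpha> \<in> v. \<forall>\<beta> \<in> v.
      card (neighbours E \<alpha> \<inter> w) = card (neighbours E \<beta> \<inter> w))"

definition vertex_regular :: "'v cgraph \<Rightarrow> bool"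
  where "vertex_regular G \<longleftrightarrow> (\<forall>u \<in> eclasses G. equitable u (vclasses G))"

definition vertex_regular_graphs :: "'v::finite cgraph set"
  where "vertex_regular_graphs = {G \<in> coloured_graphs. vertex_regular G}"

definition RCON_order :: "(real^'v^'v::finite) set gorder"
  where "RCON_order = inclusion_order (RCON ` vertex_regular_graphs)"

definition RCOR_order :: "(real^'v^'v::finite) set gorder"
  where "RCOR_order = inclusion_order (RCOR ` vertex_regular_graphs)"

text \<open>\<open>coarsest_equitable W E P\<close> is \<open>r\<^sub>H(P)\<close> for the graph \<open>H = (W, E)\<close>. For finite \<open>W\<close>
  and a partition \<open>P\<close> of \<open>W\<close> the described partition exists and is unique.\<close>

definition coarsest_equitable :: "'a set \<Rightarrow> 'a set set \<Rightarrow> 'a set set \<Rightarrow> 'a set set"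
  where "coarsest_equitable W E P =
    (THE Q. refines W Q P \<and> equitable E Q \<and>
       (\<forall>Q'. refines W Q' P \<and> equitable E Q' \<longrightarrow> refines W Q' Q))"

text \<open>In the factor graph, \<open>Inl \<alpha>\<close> stands for the vertex \<open>\<alpha>\<close> and \<open>Inr e\<close> for the node that
  represents the edge \<open>e\<close>.\<close>

definition factor_nodes :: "'v cgraph \<Rightarrow> ('v + 'v set) set"
  where "factor_nodes G = range Inl \<union> Inr ` edges G"

definition factor_edges :: "'v cgraph \<Rightarrow> ('v + 'v set) set set"
  where "factor_edges G = {{Inl \<alpha>, Inr e} | \<alpha> e. e \<in> edges G \<and> \<alpha> \<in> e}"

definition factor_partition :: "'v cgraph \<Rightarrow> ('v + 'v set) set set"
  where "factor_partition G = (`) Inl ` vclasses G \<union> (`) Inr ` eclasses G"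

definition factor_refinement :: "'v cgraph \<Rightarrow> ('v + 'v set) set set"
  where "factor_refinement G =
    coarsest_equitable (factor_nodes G) (factor_edges G) (factor_partition G)"

definition s_P :: "'v cgraph \<Rightarrow> 'v cgraph"
  where "s_P G = ({v. Inl ` v \<in> factor_refinement G}, eclasses G)"


subsection \<open>Explicit form of meet and join of coloured graphs\<close>

text \<open>Not used in any definition above: these facts confirm that meet and join in
  \<open>cgraph_order\<close> are given by the usual formulas in terms of suprema and infima of partitions.\<close>

definition partition_order :: "'a set \<Rightarrow> 'a set set gorder"
  where "partition_order A = \<lparr>carrier = {P. partition_on A P}, eq = (=), le = refines A\<rparr>"

text \<open>Subfamilies of the edge classes of \<open>G\<close> whose union is also a union of edge classes of \<open>H\<close>
  are closed under union, so the maximal one is the union of all of them.\<close>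

definition star1 :: "'v cgraph \<Rightarrow> 'v cgraph \<Rightarrow> 'v set set set"
  where "star1 G H = \<Union> {S. S \<subseteq> eclasses G \<and> (\<exists>T \<subseteq> eclasses H. \<Union> S = \<Union> T)}"

definition star2 :: "'v cgraph \<Rightarrow> 'v cgraph \<Rightarrow> 'v set set set"
  where "star2 G H = (eclasses G \<union> {edges H - edges G}) - {{}}"

lemma carrier_partition_order [simp]: "P \<in> carrier (partition_order A) \<longleftrightarrow> partition_on A P"
  by (simp add: partition_order_def)

lemma le_partition_order [simp]: "le (partition_order A) = refines A"
  by (simp add: partition_order_def)

lemma partition_order_partial: "partial_order (partition_order A)"
proof unfold_locales
  show "x .=\<^bsub>partition_order A\<^esub> y" if "x \<sqsubseteq>\<^bsub>partition_order A\<^esub> y" "y \<sqsubseteq>\<^bsub>partition_order A\<^esub> x" for x y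
    using that refines_asym[of A x y] by (simp add: partition_order_def)
  show "x \<sqsubseteq>\<^bsub>partition_order A\<^esub> z" if "x \<sqsubseteq>\<^bsub>partition_order A\<^esub> y" "y \<sqsubseteq>\<^bsub>partition_order A\<^esub> z" for x y z
    using that refines_trans[of A x y z] by (simp add: partition_order_def)
qed (simp_all add: partition_order_def refines_refl)

lemma cup_of_classes_iff:
  assumes P: "partition_on A P"
  shows "(\<exists>U \<subseteq> P. X = \<Union> U) \<longleftrightarrow> X \<subseteq> A \<and> (\<forall>p \<in> P. p \<inter> X \<noteq> {} \<longrightarrow> p \<subseteq> X)"
proof
  assume "\<exists>U \<subseteq> P. X = \<Union> U"
  then obtain U where U: "U \<subseteq> P" "X = \<Union> U" by blast
  have "p \<subseteq> X" if p: "p \<in> P" "p \<inter> X \<noteq> {}" for p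
  proof -
    from p obtain x where x: "x \<in> p" "x \<in> X" by blast
    then obtain q where q: "q \<in> U" "x \<in> q" using U by blast
    then have "p = q"
      using p x U disjointD[OF partition_onD2[OF P], of p q] by blast
    then show ?thesis using q U by blast
  qed
  moreover have "X \<subseteq> A" using U partition_onD1[OF P] by blast
  ultimately show "X \<subseteq> A \<and> (\<forall>p \<in> P. p \<inter> X \<noteq> {} \<longrightarrow> p \<subseteq> X)" by blast
next
  assume *: "X \<subseteq> A \<and> (\<forall>p \<in> P. p \<inter> X \<noteq> {} \<longrightarrow> p \<subseteq> X)"
  have "X = \<Union> {p \<in> P. p \<subseteq> X}"
    using * partition_onD1[OF P] by blast
  then show "\<exists>U \<subseteq> P. X = \<Union> U" by (metis (lifting) mem_Collect_eq subsetI)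
qed

lemma partition_on_nonempty: "partition_on A P \<Longrightarrow> p \<in> P \<Longrightarrow> \<exists>x. x \<in> p"
  by (metis all_not_in_conv partition_onD3)

lemma partition_on_subset: "partition_on A P \<Longrightarrow> S \<subseteq> P \<Longrightarrow> partition_on (\<Union> S) S"
  by (auto simp: partition_on_def disjoint_def)

lemma refines_cup:
  assumes "refines A P Q" "q \<in> Q"
  shows "\<exists>U \<subseteq> P. q = \<Union> U"
  using partition_onD1[OF refines_obtains_subset[OF assms]]
  by (metis (lifting) mem_Collect_eq subsetI)

lemma cup_refines:
  assumes P: "partition_on A P" and Q: "partition_on A Q"
    and *: "\<And>q. q \<in> Q \<Longrightarrow> \<exists>U \<subseteq> P. q = \<Union> U"
  shows "refines A P Q"
  unfolding refines_def
proof (intro conjI P Q ballI)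
  fix p assume p: "p \<in> P"
  then obtain x where x: "x \<in> p" using partition_on_nonempty[OF P] by blast
  then obtain q where q: "q \<in> Q" "x \<in> q"
    using p partition_onD1[OF P] partition_onD1[OF Q] by blast
  then have "p \<subseteq> q"
    using *[OF q(1)] p x unfolding cup_of_classes_iff[OF P] by blast
  then show "\<exists>q\<in>Q. p \<subseteq> q" using q by blast
qed

lemma partition_sup_exists:
  assumes P: "partition_on A P" and Q: "partition_on A Q"
  shows "\<exists>R. least (partition_order A) R (Upper (partition_order A) {P, Q})"
proof -
  define r where "r = {(x, y). \<exists>c \<in> P \<union> Q. x \<in> c \<and> y \<in> c}"
  define R where "R = A // r\<^sup>+"
  have "sym r" unfolding r_def sym_def by blast
  moreover have "r \<subseteq> A \<times> A"
    using partition_onD1[OF P] partition_onD1[OF Q] unfolding r_def by blast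
  moreover have "refl_on A r"
    using partition_onD1[OF P] unfolding r_def refl_on_def by blast
  ultimately have eq: "equiv A (r\<^sup>+)"
    unfolding equiv_def
    by (intro conjI sym_trancl trans_trancl trancl_subset_Sigma)
      (auto simp: refl_on_def)
  have R: "partition_on A R" unfolding R_def by (rule partition_on_quotient[OF eq])
  have up: "refines A C R" if C: "C = P \<or> C = Q" for C
    unfolding refines_def
  proof (intro conjI ballI)
    show C': "partition_on A C" using C P Q by blast
    fix c assume c: "c \<in> C"
    then obtain x where x: "x \<in> c" using partition_on_nonempty[OF C'] by blast
    then have "c \<subseteq> r\<^sup>+ `` {x}" using c C unfolding r_def by blast
    moreover have "x \<in> A" using c x partition_onD1[OF C'] by blast
    ultimately show "\<exists>d\<in>R. c \<subseteq> d" unfolding R_def by (blast intro: quotientI)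
  qed (rule R)
  have low: "refines A R T" if T: "refines A P T" "refines A Q T" for T
    unfolding refines_def
  proof (intro conjI ballI)
    show T': "partition_on A T" using T(1) by (simp add: refines_def)
    fix d assume "d \<in> R"
    then obtain x where x: "x \<in> A" "d = r\<^sup>+ `` {x}" unfolding R_def by (blast elim: quotientE)
    obtain t where t: "t \<in> T" "x \<in> t" using x(1) partition_onD1[OF T'] by blast
    have "y \<in> t" if "(x, y) \<in> r\<^sup>+" for y
      using that
    proof induction
      case (base y)
      then obtain c where c: "c \<in> P \<union> Q" "x \<in> c" "y \<in> c" unfolding r_def by blast
      then obtain t' where "t' \<in> T" "c \<subseteq> t'" using T unfolding refines_def by blast
      then show ?case using t c disjointD[OF partition_onD2[OF T'], of t t'] by blast
    next
      case (step y z)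
      then obtain c where c: "c \<in> P \<union> Q" "y \<in> c" "z \<in> c" unfolding r_def by blast
      then obtain t' where "t' \<in> T" "c \<subseteq> t'" using T unfolding refines_def by blast
      then show ?case using t c step disjointD[OF partition_onD2[OF T'], of t t'] by blast
    qed
    then show "\<exists>t\<in>T. d \<subseteq> t" using t x by blast
  qed (rule R)
  have "least (partition_order A) R (Upper (partition_order A) {P, Q})"
    using P Q R up low by (auto simp: least_def Upper_def)
  then show ?thesis ..
qed

lemma partition_inf_exists:
  assumes P: "partition_on A P" and Q: "partition_on A Q"
  shows "\<exists>R. greatest (partition_order A) R (Lower (partition_order A) {P, Q})"
proof -
  let ?R = "common_refinement {P, Q}"
  have "partition_on A ?R"
    by (rule partition_on_common_refinement) (use P Q in auto)
  moreover have "refines A ?R P" "refines A ?R Q"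
    by (rule refines_common_refinement; use P Q in auto)+
  moreover have "refines A T ?R" if "refines A T P" "refines A T Q" for T
    by (rule common_refinement_coarsest) (use that P Q in \<open>auto simp: refines_def\<close>)
  ultimately have "greatest (partition_order A) ?R (Lower (partition_order A) {P, Q})"
    using P Q by (auto simp: greatest_def Lower_def)
  then show ?thesis ..
qed

lemma partition_join:
  assumes P: "partition_on A P" and Q: "partition_on A Q"
  shows "refines A P (P \<squnion>\<^bsub>partition_order A\<^esub> Q)" "refines A Q (P \<squnion>\<^bsub>partition_order A\<^esub> Q)"
    and "refines A P T \<Longrightarrow> refines A Q T \<Longrightarrow> refines A (P \<squnion>\<^bsub>partition_order A\<^esub> Q) T"
proof -
  have *: "least (partition_order A) (P \<squnion>\<^bsub>partition_order A\<^esub> Q) (Upper (partition_order A) {P, Q})"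
    unfolding join_def sup_def by (rule someI_ex[OF partition_sup_exists[OF P Q]])
  then show "refines A P (P \<squnion>\<^bsub>partition_order A\<^esub> Q)" "refines A Q (P \<squnion>\<^bsub>partition_order A\<^esub> Q)"
    using P Q by (auto simp: least_def Upper_def)
  show "refines A P T \<Longrightarrow> refines A Q T \<Longrightarrow> refines A (P \<squnion>\<^bsub>partition_order A\<^esub> Q) T"
    using * P Q by (auto simp: least_def Upper_def refines_def[of A P T])
qed

lemma partition_meet:
  assumes P: "partition_on A P" and Q: "partition_on A Q"
  shows "refines A (P \<sqinter>\<^bsub>partition_order A\<^esub> Q) P" "refines A (P \<sqinter>\<^bsub>partition_order A\<^esub> Q) Q"
    and "refines A T P \<Longrightarrow> refines A T Q \<Longrightarrow> refines A T (P \<sqinter>\<^bsub>partition_order A\<^esub> Q)"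
proof -
  have *: "greatest (partition_order A) (P \<sqinter>\<^bsub>partition_order A\<^esub> Q) (Lower (partition_order A) {P, Q})"
    unfolding meet_def inf_def by (rule someI_ex[OF partition_inf_exists[OF P Q]])
  then show "refines A (P \<sqinter>\<^bsub>partition_order A\<^esub> Q) P" "refines A (P \<sqinter>\<^bsub>partition_order A\<^esub> Q) Q"
    using P Q by (auto simp: greatest_def Lower_def)
  show "refines A T P \<Longrightarrow> refines A T Q \<Longrightarrow> refines A T (P \<sqinter>\<^bsub>partition_order A\<^esub> Q)"
    using * P Q by (auto simp: greatest_def Lower_def refines_def[of A T P])
qed

lemma coloured_graphs_iff:
  "G \<in> coloured_graphs \<longleftrightarrow> partition_on UNIV (vclasses G) \<and>
     edges G \<subseteq> {e. card e = 2} \<and> partition_on (edges G) (eclasses G)"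
  unfolding coloured_graphs_def edges_def by (auto dest: partition_onD1)

lemma carrier_cgraph_order [simp]: "carrier cgraph_order = coloured_graphs"
  by (simp add: cgraph_order_def)

lemma le_cgraph_order [simp]: "le cgraph_order = cgraph_le"
  by (simp add: cgraph_order_def)

lemma cgraph_le_classes: "cgraph_le G H \<Longrightarrow> u \<in> eclasses G \<Longrightarrow> \<exists>U \<subseteq> eclasses H. u = \<Union> U"
  by (simp add: cgraph_le_def)

lemma cgraph_le_trans:
  assumes GH: "cgraph_le G H" and HK: "cgraph_le H K"
  shows "cgraph_le G K"
  unfolding cgraph_le_def
proof (intro conjI ballI)
  show "edges G \<subseteq> edges K"
    using GH HK unfolding cgraph_le_def by (meson order_trans)
  show "refines UNIV (vclasses K) (vclasses G)"
    using GH HK unfolding cgraph_le_def by (meson refines_trans)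
  fix u assume "u \<in> eclasses G"
  then obtain U where U: "U \<subseteq> eclasses H" "u = \<Union> U" using cgraph_le_classes[OF GH] by metis
  have "x \<in> \<Union> {k \<in> eclasses K. k \<subseteq> u}" if x: "x \<in> u" for x
  proof -
    obtain w where w: "w \<in> U" "x \<in> w" using x U(2) by blast
    obtain W where W: "W \<subseteq> eclasses K" "w = \<Union> W"
      using cgraph_le_classes[OF HK] w(1) U(1) by (meson subsetD)
    then obtain k where "k \<in> W" "x \<in> k" using w(2) by blast
    moreover have "k \<subseteq> u" using \<open>k \<in> W\<close> W(2) w(1) U(2) by blast
    ultimately show ?thesis using W(1) by blast
  qed
  then have "u = \<Union> {k \<in> eclasses K. k \<subseteq> u}" by blast
  moreover have "{k \<in> eclasses K. k \<subseteq> u} \<subseteq> eclasses K" by blast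
  ultimately show "\<exists>U \<subseteq> eclasses K. u = \<Union> U" by (intro exI conjI)
qed

lemma cgraph_le_antisym:
  assumes G: "G \<in> coloured_graphs" and H: "H \<in> coloured_graphs"
    and "cgraph_le G H" "cgraph_le H G"
  shows "G = H"
proof -
  have e: "edges G = edges H" using assms unfolding cgraph_le_def by (meson subset_antisym)
  have "refines (edges G) (eclasses H) (eclasses G)"
    by (rule cup_refines) (use assms e in \<open>simp_all add: coloured_graphs_iff cgraph_le_def\<close>)
  moreover have "refines (edges G) (eclasses G) (eclasses H)"
    by (rule cup_refines) (use assms e in \<open>simp_all add: coloured_graphs_iff cgraph_le_def\<close>)
  ultimately have "eclasses G = eclasses H" by (rule refines_asym[rotated])
  moreover have "vclasses G = vclasses H"
    using assms refines_asym[of UNIV "vclasses G" "vclasses H"] by (simp add: cgraph_le_def)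
  ultimately show ?thesis by (simp add: prod_eq_iff)
qed

lemma cgraph_le_refl: "G \<in> coloured_graphs \<Longrightarrow> cgraph_le G G"
  unfolding cgraph_le_def coloured_graphs_iff
proof (intro conjI ballI)
  show "\<exists>U \<subseteq> eclasses G. u = \<Union> U" if "u \<in> eclasses G" for u
    using that by (intro exI[of _ "{u}"]) simp
qed (simp_all add: refines_refl)

lemma cgraph_order_partial: "partial_order (cgraph_order :: 'v::finite cgraph gorder)"
proof unfold_locales
  let ?L = "cgraph_order :: 'v cgraph gorder"
  show "x .=\<^bsub>?L\<^esub> y" if "x \<sqsubseteq>\<^bsub>?L\<^esub> y" "y \<sqsubseteq>\<^bsub>?L\<^esub> x" "x \<in> carrier ?L" "y \<in> carrier ?L" for x y
    using that cgraph_le_antisym[of x y] by (simp add: cgraph_order_def)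
  show "x \<sqsubseteq>\<^bsub>?L\<^esub> z" if "x \<sqsubseteq>\<^bsub>?L\<^esub> y" "y \<sqsubseteq>\<^bsub>?L\<^esub> z" for x y z
    using that cgraph_le_trans[of x y z] by (simp add: cgraph_order_def)
qed (simp_all add: cgraph_order_def cgraph_le_refl)

lemma cgraph_meet_eqI:
  assumes "G \<in> coloured_graphs" "H \<in> coloured_graphs" "M \<in> coloured_graphs"
    and "cgraph_le M G" "cgraph_le M H"
    and "\<And>K. K \<in> coloured_graphs \<Longrightarrow> cgraph_le K G \<Longrightarrow> cgraph_le K H \<Longrightarrow> cgraph_le K M"
  shows "G \<sqinter>\<^bsub>cgraph_order\<^esub> H = M"
  unfolding meet_def inf_def
proof (rule some_equality)
  show M: "greatest cgraph_order M (Lower cgraph_order {G, H})"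
    using assms by (simp add: greatest_def Lower_def del: split_paired_All)
  show "N = M" if "greatest cgraph_order N (Lower cgraph_order {G, H})" for N
  proof (rule cgraph_le_antisym)
    show "N \<in> coloured_graphs" "cgraph_le N M" "cgraph_le M N"
      using that M by (simp_all add: greatest_def Lower_def)
  qed (rule assms)
qed

lemma cgraph_join_eqI:
  assumes "G \<in> coloured_graphs" "H \<in> coloured_graphs" "M \<in> coloured_graphs"
    and "cgraph_le G M" "cgraph_le H M"
    and "\<And>K. K \<in> coloured_graphs \<Longrightarrow> cgraph_le G K \<Longrightarrow> cgraph_le H K \<Longrightarrow> cgraph_le M K"
  shows "G \<squnion>\<^bsub>cgraph_order\<^esub> H = M"
  unfolding join_def sup_def
proof (rule some_equality)
  show M: "least cgraph_order M (Upper cgraph_order {G, H})"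
    using assms by (simp add: least_def Upper_def del: split_paired_All)
  show "N = M" if "least cgraph_order N (Upper cgraph_order {G, H})" for N
  proof (rule cgraph_le_antisym)
    show "N \<in> coloured_graphs" "cgraph_le N M" "cgraph_le M N"
      using that M by (simp_all add: least_def Upper_def)
  qed (rule assms)
qed

lemma star1_subset: "star1 G H \<subseteq> eclasses G"
  unfolding star1_def by (rule Union_least) simp

lemma star1I:
  assumes "S \<subseteq> eclasses G" "T \<subseteq> eclasses H" "\<Union> S = \<Union> T"
  shows "S \<subseteq> star1 G H"
  unfolding star1_def by (rule Union_upper) (use assms in \<open>intro CollectI conjI exI\<close>)

lemma Union_star1_subset: "\<Union> (star1 G H) \<subseteq> \<Union> (star1 H G)"
proof
  fix e assume "e \<in> \<Union> (star1 G H)"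
  then obtain s where s: "s \<in> star1 G H" "e \<in> s" by blast
  then obtain S where S: "S \<subseteq> eclasses G" "\<exists>T \<subseteq> eclasses H. \<Union> S = \<Union> T" "s \<in> S"
    unfolding star1_def Union_iff Bex_def mem_Collect_eq by metis
  then obtain T where T: "T \<subseteq> eclasses H" "\<Union> S = \<Union> T" by metis
  have "e \<in> \<Union> T" unfolding T(2)[symmetric] using s(2) S(3) by blast
  have "T \<subseteq> star1 H G" by (rule star1I[OF T(1) S(1) T(2)[symmetric]])
  then show "e \<in> \<Union> (star1 H G)" using \<open>e \<in> \<Union> T\<close> by blast
qed

lemma Union_star1: "\<Union> (star1 H G) = \<Union> (star1 G H)"
  by (rule subset_antisym) (rule Union_star1_subset)+

theorem cgraph_meet:
  assumes G: "G \<in> coloured_graphs" and H: "H \<in> coloured_graphs"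
  shows "G \<sqinter>\<^bsub>cgraph_order\<^esub> H =
    (vclasses G \<squnion>\<^bsub>partition_order UNIV\<^esub> vclasses H,
     star1 G H \<squnion>\<^bsub>partition_order (\<Union> (star1 G H))\<^esub> star1 H G)"
proof -
  let ?A = "\<Union> (star1 G H)"
  let ?V = "vclasses G \<squnion>\<^bsub>partition_order UNIV\<^esub> vclasses H"
  let ?E = "star1 G H \<squnion>\<^bsub>partition_order ?A\<^esub> star1 H G"
  have vG: "partition_on UNIV (vclasses G)" and eG: "partition_on (edges G) (eclasses G)"
    and vH: "partition_on UNIV (vclasses H)" and eH: "partition_on (edges H) (eclasses H)"
    using G H by (auto simp: coloured_graphs_iff)
  have sG: "partition_on ?A (star1 G H)"
    by (rule partition_on_subset[OF eG star1_subset])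
  have sH: "partition_on ?A (star1 H G)"
    using partition_on_subset[OF eH star1_subset, of G] by (simp add: Union_star1)
  note V = partition_join[OF vG vH] and E = partition_join[OF sG sH]
  have E': "partition_on ?A ?E" using E(1) by (simp add: refines_def)
  then have A: "edges (?V, ?E) = ?A" using partition_onD1[OF E'] by (simp add: edges_def)
  have AG: "?A \<subseteq> edges G" using star1_subset[of G H] by (auto simp: edges_def)
  have AH: "?A \<subseteq> edges H"
    using star1_subset[of H G] Union_star1[of G H] by (auto simp: edges_def)
  show ?thesis
  proof (rule cgraph_meet_eqI[OF G H])
    show "(?V, ?E) \<in> coloured_graphs"
      using V(1) E' AG G by (auto simp: coloured_graphs_iff A refines_def)
    have "\<exists>U \<subseteq> eclasses G. u = \<Union> U" "\<exists>U \<subseteq> eclasses H. u = \<Union> U" if "u \<in> ?E" for u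
      using refines_cup[OF E(1) that] refines_cup[OF E(2) that]
        star1_subset[of G H] star1_subset[of H G] by (meson order_trans)+
    then show "cgraph_le (?V, ?E) G" "cgraph_le (?V, ?E) H"
      using AG AH V(1,2) by (simp_all add: cgraph_le_def A)
  next
    fix K :: "'a cgraph" assume K: "K \<in> coloured_graphs" and le: "cgraph_le K G" "cgraph_le K H"
    have eK: "partition_on (edges K) (eclasses K)" using K by (simp add: coloured_graphs_iff)
    have *: "{p \<in> eclasses X. p \<subseteq> edges K} \<subseteq> star1 X Y \<and> \<Union> {p \<in> eclasses X. p \<subseteq> edges K} = edges K"
      if "cgraph_le K X" "cgraph_le K Y" for X Y
    proof -
      have cov: "\<Union> {p \<in> eclasses Z. p \<subseteq> edges K} = edges K" if Z: "cgraph_le K Z" for Z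
      proof
        show "edges K \<subseteq> \<Union> {p \<in> eclasses Z. p \<subseteq> edges K}"
        proof
          fix e assume "e \<in> edges K"
          then obtain k where k: "k \<in> eclasses K" "e \<in> k" by (auto simp: edges_def)
          then obtain U where U: "U \<subseteq> eclasses Z" "k = \<Union> U"
            using cgraph_le_classes[OF Z] by metis
          have "k \<subseteq> edges K" using k by (auto simp: edges_def)
          then show "e \<in> \<Union> {p \<in> eclasses Z. p \<subseteq> edges K}" using U k by blast
        qed
      qed blast
      have "{p \<in> eclasses X. p \<subseteq> edges K} \<subseteq> star1 X Y"
        by (rule star1I[of _ _ "{p \<in> eclasses Y. p \<subseteq> edges K}"])
          (simp_all add: cov[OF that(1)] cov[OF that(2)])
      then show ?thesis using cov[OF that(1)] by simp
    qed
    have KA: "edges K \<subseteq> ?A" using *[OF le] by (metis (no_types, lifting) Union_mono)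
    define Q where "Q = (eclasses K \<union> {?A - edges K}) - {{}}"
    have Q: "partition_on ?A Q"
      unfolding partition_on_def
    proof (intro conjI)
      show "\<Union> Q = ?A" using KA unfolding Q_def edges_def by blast
      show "disjoint Q"
        using partition_onD2[OF eK] by (auto simp: Q_def edges_def disjoint_def)
      show "{} \<notin> Q" by (simp add: Q_def)
    qed
    have ref: "refines ?A (star1 X Y) Q"
      if X: "cgraph_le K X" "partition_on (edges X) (eclasses X)" "partition_on ?A (star1 X Y)" for X Y
      unfolding refines_def
    proof (intro conjI ballI X(3) Q)
      fix q assume q: "q \<in> star1 X Y"
      then have q': "q \<in> eclasses X" "q \<noteq> {}" "q \<subseteq> ?A"
        using star1_subset[of X Y] partition_onD3[OF X(3)] partition_onD1[OF X(3)] by blast+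
      show "\<exists>r\<in>Q. q \<subseteq> r"
      proof (cases "q \<inter> edges K = {}")
        case True
        then have "q \<subseteq> ?A - edges K" using q' by blast
        moreover from this have "?A - edges K \<in> Q" using q'(2) unfolding Q_def by blast
        ultimately show ?thesis by blast
      next
        case False
        then obtain k where k: "k \<in> eclasses K" "q \<inter> k \<noteq> {}" by (auto simp: edges_def)
        have "\<exists>U \<subseteq> eclasses X. k = \<Union> U" using X(1) k(1) by (auto simp: cgraph_le_def)
        then have "q \<subseteq> k" using q'(1) k(2) unfolding cup_of_classes_iff[OF X(2)] by blast
        moreover have "k \<in> Q" using k unfolding Q_def by blast
        ultimately show ?thesis by blast
      qed
    qed
    have EQ: "refines ?A ?E Q"
      using ref[OF le(1) eG sG] ref[OF le(2) eH sH] by (rule E(3))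
    have "\<exists>U \<subseteq> ?E. k = \<Union> U" if "k \<in> eclasses K" for k
      using that partition_onD3[OF eK] by (intro refines_cup[OF EQ]) (auto simp: Q_def)
    moreover have "refines UNIV ?V (vclasses K)"
      using le by (intro V(3)) (simp_all add: cgraph_le_def)
    ultimately show "cgraph_le K (?V, ?E)" using KA by (simp add: cgraph_le_def A)
  qed
qed

theorem cgraph_join:
  assumes G: "G \<in> coloured_graphs" and H: "H \<in> coloured_graphs"
  shows "G \<squnion>\<^bsub>cgraph_order\<^esub> H =
    (vclasses G \<sqinter>\<^bsub>partition_order UNIV\<^esub> vclasses H,
     star2 G H \<sqinter>\<^bsub>partition_order (edges G \<union> edges H)\<^esub> star2 H G)"
proof -
  let ?A = "edges G \<union> edges H"
  let ?V = "vclasses G \<sqinter>\<^bsub>partition_order UNIV\<^esub> vclasses H"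
  let ?E = "star2 G H \<sqinter>\<^bsub>partition_order ?A\<^esub> star2 H G"
  have vG: "partition_on UNIV (vclasses G)" and eG: "partition_on (edges G) (eclasses G)"
    and vH: "partition_on UNIV (vclasses H)" and eH: "partition_on (edges H) (eclasses H)"
    using G H by (auto simp: coloured_graphs_iff)
  have st: "partition_on (edges X \<union> edges Y) (star2 X Y)"
    if "partition_on (edges X) (eclasses X)" for X Y :: "'a cgraph"
    unfolding partition_on_def
  proof (intro conjI)
    show "\<Union> (star2 X Y) = edges X \<union> edges Y"
      by (auto simp: star2_def edges_def)
    show "disjoint (star2 X Y)"
      using partition_onD2[OF that] by (auto simp: star2_def edges_def disjoint_def)
    show "{} \<notin> star2 X Y" by (simp add: star2_def)
  qed
  have sG: "partition_on ?A (star2 G H)" by (rule st[OF eG])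
  have sH: "partition_on ?A (star2 H G)" using st[OF eH, of G] by (simp add: Un_commute)
  note V = partition_meet[OF vG vH] and E = partition_meet[OF sG sH]
  have E': "partition_on ?A ?E" using E(1) by (simp add: refines_def)
  then have A: "edges (?V, ?E) = ?A" using partition_onD1[OF E'] by (simp add: edges_def)
  show ?thesis
  proof (rule cgraph_join_eqI[OF G H])
    show "(?V, ?E) \<in> coloured_graphs"
      using V(1) E' G H by (auto simp: coloured_graphs_iff A refines_def)
    have "\<exists>U \<subseteq> ?E. u = \<Union> U" if "u \<in> eclasses G" for u
      using that partition_onD3[OF eG] by (intro refines_cup[OF E(1)]) (auto simp: star2_def)
    then show "cgraph_le G (?V, ?E)" using V(1) by (simp add: cgraph_le_def A)
    have "\<exists>U \<subseteq> ?E. u = \<Union> U" if "u \<in> eclasses H" for u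
      using that partition_onD3[OF eH] by (intro refines_cup[OF E(2)]) (auto simp: star2_def)
    then show "cgraph_le H (?V, ?E)" using V(2) by (simp add: cgraph_le_def A)
  next
    fix K :: "'a cgraph" assume K: "K \<in> coloured_graphs" and le: "cgraph_le G K" "cgraph_le H K"
    have eK: "partition_on (edges K) (eclasses K)" using K by (simp add: coloured_graphs_iff)
    have AK: "?A \<subseteq> edges K" using le by (simp add: cgraph_le_def)
    have cl: "k \<subseteq> u" if "cgraph_le X K" "u \<in> eclasses X" "k \<in> eclasses K" "k \<inter> u \<noteq> {}" for X u k
    proof -
      have "\<exists>U \<subseteq> eclasses K. u = \<Union> U" using that by (simp add: cgraph_le_def)
      then show ?thesis using that(3,4) unfolding cup_of_classes_iff[OF eK] by blast
    qed
    have cle: "k \<subseteq> edges X" if k: "cgraph_le X K" "k \<in> eclasses K" "k \<inter> edges X \<noteq> {}" for X k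
    proof -
      obtain u where u: "u \<in> eclasses X" "k \<inter> u \<noteq> {}" using k(3) unfolding edges_def by blast
      then have "k \<subseteq> u" using cl[OF k(1) _ k(2)] by blast
      then show ?thesis using u(1) unfolding edges_def by blast
    qed
    have cls: "k \<subseteq> s"
      if "cgraph_le X K" "cgraph_le Y K" "s \<in> star2 X Y" "k \<in> eclasses K" "k \<inter> s \<noteq> {}" for X Y s k
    proof (cases "s \<in> eclasses X")
      case True
      then show ?thesis using cl[OF that(1) _ that(4,5)] by blast
    next
      case False
      then have s: "s = edges Y - edges X" using that(3) by (simp add: star2_def)
      then have "k \<subseteq> edges Y" using cle[OF that(2,4)] that(5) by blast
      moreover have "k \<inter> edges X = {}" using cle[OF that(1,4)] that(5) s by blast
      ultimately show ?thesis using s by blast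
    qed
    define L where "L = {k \<in> eclasses K. k \<subseteq> ?A}"
    have "\<Union> L = ?A"
    proof
      show "?A \<subseteq> \<Union> L"
      proof
        fix e assume e: "e \<in> ?A"
        then obtain k where "k \<in> eclasses K" "e \<in> k" using AK by (auto simp: edges_def)
        then show "e \<in> \<Union> L" using e cle[OF le(1)] cle[OF le(2)] unfolding L_def by blast
      qed
    qed (auto simp: L_def)
    then have L: "partition_on ?A L"
      using partition_on_subset[OF eK, of L] by (simp add: L_def)
    have ref: "refines ?A L (star2 X Y)"
      if X: "cgraph_le X K" "cgraph_le Y K" "partition_on ?A (star2 X Y)" for X Y
      unfolding refines_def
    proof (intro conjI ballI L X(3))
      fix k assume k: "k \<in> L"
      then obtain e where e: "e \<in> k" "e \<in> ?A"
        using partition_on_nonempty[OF L] unfolding L_def by blast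
      then obtain s where s: "s \<in> star2 X Y" "e \<in> s" using partition_onD1[OF X(3)] by blast
      then have "k \<subseteq> s" using cls[OF X(1,2) s(1)] k e unfolding L_def by blast
      then show "\<exists>s\<in>star2 X Y. k \<subseteq> s" using s by blast
    qed
    have "refines ?A L ?E"
      using ref[OF le sG] ref[OF le(2,1) sH] by (rule E(3))
    have "\<exists>U \<subseteq> eclasses K. u = \<Union> U" if u: "u \<in> ?E" for u
    proof -
      obtain U where U: "U \<subseteq> L" "u = \<Union> U"
        using refines_cup[OF \<open>refines ?A L ?E\<close> u] by metis
      have "U \<subseteq> eclasses K" using U(1) by (auto simp: L_def)
      then show ?thesis using U(2) by (intro exI conjI)
    qed
    moreover have "refines UNIV (vclasses K) ?V"
      using le by (intro V(3)) (simp_all add: cgraph_le_def)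
    ultimately show "cgraph_le (?V, ?E) K" using AK by (simp add: cgraph_le_def A)
  qed
qed

end

theory Submission
  imports Defs
begin

text \<open>Adding to the edge classes of a coloured graph one class for the non-edges turns the order on
  coloured graphs into refinement of partitions, and membership of \<open>K\<close> in either model says that
  the diagonal and the (scaled) off-diagonal entries of \<open>K\<close> are constant on classes. A matrix
  close to a diagonal one can separate all classes, so both \<open>RCON\<close> and \<open>RCOR\<close> are order
  embeddings, and the claim is about coloured graphs only. There, vertex regularity is preserved
  by meets since equitability passes to unions of edge classes and to joins of vertex partitions;
  together with the top graph this gives a complete lattice. For the join, a vertex partition is
  equitable for all edge classes iff it is the vertex part of an equitable partition of
  the factor graph refining the edge classes, so the refinement in the factor graph yields the
  coarsest such vertex partition.\<close>


section \<open>Partitions into level sets\<close>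

definition level_sets :: "'a set \<Rightarrow> ('a \<Rightarrow> 'b) \<Rightarrow> 'a set set"
  where "level_sets A f = (\<lambda>x. {y \<in> A. f y = f x}) ` A"

lemma partition_on_level_sets: "partition_on A (level_sets A f)"
  by (auto simp: partition_on_def disjoint_def level_sets_def)

text \<open>The bridge between being constant on every class and refinement: degree counts and
  matrix entries that are constant on classes are handled as level-set partitions, to which the
  universal property of partition joins applies.\<close>

lemma refines_level_sets_iff:
  assumes P: "partition_on A P"
  shows "refines A P (level_sets A f) \<longleftrightarrow> (\<forall>p \<in> P. \<forall>x \<in> p. \<forall>y \<in> p. f x = f y)"
proof
  assume *: "refines A P (level_sets A f)"
  show "\<forall>p \<in> P. \<forall>x \<in> p. \<forall>y \<in> p. f x = f y"
  proof (intro ballI)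
    fix p x y assume p: "p \<in> P" "x \<in> p" "y \<in> p"
    obtain z where "p \<subseteq> {y \<in> A. f y = f z}"
      using * p(1) unfolding refines_def level_sets_def by blast
    then have "f x = f z" "f y = f z" using p by blast+
    then show "f x = f y" by simp
  qed
next
  assume const: "\<forall>p \<in> P. \<forall>x \<in> p. \<forall>y \<in> p. f x = f y"
  have "\<exists>q \<in> level_sets A f. p \<subseteq> q" if p: "p \<in> P" for p
  proof -
    obtain x where x: "x \<in> p" using partition_on_nonempty[OF P p] by blast
    have A: "p \<subseteq> A" using p partition_onD1[OF P] by blast
    have "f y = f x" if "y \<in> p" for y using const p x that by blast
    then have "p \<subseteq> {y \<in> A. f y = f x}" using A by auto
    moreover have "x \<in> A" using A x by blast
    ultimately show ?thesis unfolding level_sets_def by blast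
  qed
  then show "refines A P (level_sets A f)"
    using P by (simp add: refines_def partition_on_level_sets)
qed

lemma partition_on_class_unique:
  "partition_on A P \<Longrightarrow> p \<in> P \<Longrightarrow> q \<in> P \<Longrightarrow> x \<in> p \<Longrightarrow> x \<in> q \<Longrightarrow> p = q"
  by (metis IntI disjointD empty_iff partition_onD2)

text \<open>As \<open>A\<close> is finite, \<open>h\<close> numbers the classes below
  \<open>n\<close>; differences of these numbers, scaled by \<open>\<delta> / n\<close>, separate
  the classes and stay within the bound. Such functions will later prescribe matrix entries; for
  edges, \<open>z\<close> is the label \<open>{}\<close>.\<close>

lemma partition_as_level_sets:
  assumes P: "partition_on A P" and "finite A" and z: "z \<in> A" and \<delta>: "\<delta> > 0"
  obtains f :: "'a \<Rightarrow> real" where "level_sets A f = P" "f z = 0" "\<And>x. \<bar>f x\<bar> \<le> \<delta>"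
proof -
  define c where "c x = (THE p. p \<in> P \<and> x \<in> p)" for x
  have c: "c x = p" if "p \<in> P" "x \<in> p" for x p
    unfolding c_def by (rule the_equality) (use that partition_on_class_unique[OF P] in blast)+
  have cA: "c x \<in> P \<and> x \<in> c x" if "x \<in> A" for x
    using that partition_onD1[OF P] c by (metis UnionE)
  have finP: "finite P" by (rule finite_elements[OF \<open>finite A\<close> P])
  then obtain h :: "'a set \<Rightarrow> nat" and n where h: "h ` P = {i. i < n}" "inj_on h P"
    using finite_imp_inj_to_nat_seg by metis
  have hn: "h p < n" if "p \<in> P" for p using h(1) that by blast
  have n: "n > 0" using hn cA[OF z] by fastforce
  \<comment> \<open>Subtracting the number of the class of \<open>z\<close> gives value 0 there; the
    value 0 outside \<open>A\<close> extends the bound to all arguments.\<close>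
  define f where "f x = (if x \<in> A then \<delta> * (real (h (c x)) - real (h (c z))) / n else 0)" for x
  show thesis
  proof
    show "f z = 0" by (simp add: f_def)
    show "\<bar>f x\<bar> \<le> \<delta>" for x
    proof (cases "x \<in> A")
      case True
      then have "\<bar>real (h (c x)) - real (h (c z))\<bar> \<le> n"
        using hn[of "c x"] hn[of "c z"] cA z by fastforce
      then have "\<delta> * \<bar>real (h (c x)) - real (h (c z))\<bar> \<le> \<delta> * n"
        using \<delta> by simp
      then show ?thesis using True \<delta> n by (simp add: f_def abs_mult pos_divide_le_eq)
    qed (use \<delta> in \<open>simp add: f_def\<close>)
    have f_eq: "f x = f y \<longleftrightarrow> c x = c y" if "x \<in> A" "y \<in> A" for x y
      using that \<delta> n inj_onD[OF h(2), of "c x" "c y"] cA by (auto simp: f_def)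
    have "{y \<in> A. f y = f x} = c x" if "x \<in> A" for x
    proof
      show "{y \<in> A. f y = f x} \<subseteq> c x" using f_eq cA that by auto
      show "c x \<subseteq> {y \<in> A. f y = f x}"
      proof
        fix y assume y: "y \<in> c x"
        then have "y \<in> A" "c y = c x" using c cA[OF that] partition_onD1[OF P] by blast+
        then show "y \<in> {y \<in> A. f y = f x}" using f_eq that by simp
      qed
    qed
    then have "level_sets A f = c ` A" by (simp add: level_sets_def)
    also have "\<dots> = P"
    proof
      show "c ` A \<subseteq> P" using cA by blast
      show "P \<subseteq> c ` A"
      proof
        fix p assume p: "p \<in> P"
        then obtain x where "x \<in> p" using partition_on_nonempty[OF P] by blast
        then show "p \<in> c ` A" using p c partition_onD1[OF P] by blast
      qed
    qed
    finally show "level_sets A f = P" .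
  qed
qed


section \<open>Equitable partitions\<close>

text \<open>Classes are disjoint, so the count into a union of classes is the sum of the counts into
  each of them.\<close>

lemma card_neighbours_cup:
  assumes P: "partition_on A P" and "finite A" and eq: "equitable E P" and S: "S \<subseteq> P"
    and v: "v \<in> P" "\<alpha> \<in> v" "\<beta> \<in> v"
  shows "card (neighbours E \<alpha> \<inter> \<Union> S) = card (neighbours E \<beta> \<inter> \<Union> S)"
proof -
  have fin: "finite S" "\<And>w. w \<in> S \<Longrightarrow> finite w"
    using S finite_elements[OF \<open>finite A\<close> P] partition_onD1[OF P] \<open>finite A\<close>
    by (blast intro: finite_subset[of _ P], meson Union_upper finite_subset subsetD)
  have "card (neighbours E x \<inter> \<Union> S) = (\<Sum>w\<in>S. card (neighbours E x \<inter> w))" for x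
    unfolding Int_Union
  proof (rule card_UN_disjoint)
    show "\<forall>i\<in>S. \<forall>j\<in>S. i \<noteq> j \<longrightarrow> neighbours E x \<inter> i \<inter> (neighbours E x \<inter> j) = {}"
      using S disjointD[OF partition_onD2[OF P]] by blast
  qed (use fin in auto)
  moreover have "card (neighbours E \<alpha> \<inter> w) = card (neighbours E \<beta> \<inter> w)" if "w \<in> S" for w
    using eq v S that unfolding equitable_def by blast
  ultimately show ?thesis by simp
qed

text \<open>A class \<open>w\<close> of the join is a union of classes of \<open>P\<close> and also
  of \<open>Q\<close>, so the degree into \<open>w\<close> is constant on the classes of both. Hence
  both partitions refine the level sets of this degree, and so does their join.\<close>

lemma equitable_join:
  assumes P: "partition_on A P" "equitable E P" and Q: "partition_on A Q" "equitable E Q"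
    and "finite A"
  shows "equitable E (P \<squnion>\<^bsub>partition_order A\<^esub> Q)"
proof -
  let ?R = "P \<squnion>\<^bsub>partition_order A\<^esub> Q"
  note R = partition_join[OF P(1) Q(1)]
  have R': "partition_on A ?R" using R(1) by (simp add: refines_def)
  have level: "refines A ?R (level_sets A (\<lambda>\<alpha>. card (neighbours E \<alpha> \<inter> w)))" if w: "w \<in> ?R" for w
  proof (rule R(3))
    have *: "refines A X (level_sets A (\<lambda>\<alpha>. card (neighbours E \<alpha> \<inter> w)))"
      if X: "partition_on A X" "equitable E X" "refines A X ?R" for X
    proof -
      obtain U where "U \<subseteq> X" "w = \<Union> U" using refines_cup[OF X(3) w] by metis
      then show ?thesis
        using card_neighbours_cup[OF X(1) \<open>finite A\<close> X(2)]
        unfolding refines_level_sets_iff[OF X(1)] by blast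
    qed
    show "refines A P (level_sets A (\<lambda>\<alpha>. card (neighbours E \<alpha> \<inter> w)))"
      "refines A Q (level_sets A (\<lambda>\<alpha>. card (neighbours E \<alpha> \<inter> w)))"
      using *[OF P R(1)] *[OF Q R(2)] by blast+
  qed
  then show ?thesis unfolding equitable_def refines_level_sets_iff[OF R'] by blast
qed

text \<open>Neighbour sets with respect to disjoint edge sets are disjoint, so degrees add up over
  \<open>S\<close>.\<close>

lemma equitable_Union:
  fixes S :: "'v::finite set set set"
  assumes "disjoint S" and eq: "\<And>s. s \<in> S \<Longrightarrow> equitable s P"
  shows "equitable (\<Union> S) P"
proof -
  have sum: "card (neighbours (\<Union> S) x \<inter> w) = (\<Sum>s\<in>S. card (neighbours s x \<inter> w))" for x w
  proof -
    have "neighbours (\<Union> S) x \<inter> w = (\<Union>s\<in>S. neighbours s x \<inter> w)"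
      by (auto simp: neighbours_def)
    moreover have "\<forall>s\<in>S. \<forall>t\<in>S. s \<noteq> t \<longrightarrow> neighbours s x \<inter> w \<inter> (neighbours t x \<inter> w) = {}"
      using disjointD[OF \<open>disjoint S\<close>] by (fastforce simp: neighbours_def)
    ultimately show ?thesis using card_UN_disjoint[of S "\<lambda>s. neighbours s x \<inter> w"] by simp
  qed
  show ?thesis
    unfolding equitable_def sum
  proof (intro ballI sum.cong refl)
    fix v w \<alpha> \<beta> s assume "v \<in> P" "w \<in> P" "\<alpha> \<in> v" "\<beta> \<in> v" "s \<in> S"
    then show "card (neighbours s \<alpha> \<inter> w) = card (neighbours s \<beta> \<inter> w)"
      using eq unfolding equitable_def by blast
  qed
qed

section \<open>Existence of the coarsest equitable refinement\<close>

lemma equitable_singletons: "equitable E ((\<lambda>x. {x}) ` A)"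
  by (auto simp: equitable_def)

text \<open>Induction gives an upper bound in \<open>S\<close> for each finite subset; the case of
  \<open>S\<close> itself is the claim.\<close>

lemma finite_directed_has_greatest:
  assumes "finite S" "S \<noteq> {}"
    and trans: "\<And>x y z. r x y \<Longrightarrow> r y z \<Longrightarrow> r x z"
    and directed: "\<And>x y. x \<in> S \<Longrightarrow> y \<in> S \<Longrightarrow> \<exists>z \<in> S. r x z \<and> r y z"
  shows "\<exists>z \<in> S. \<forall>x \<in> S. r x z"
proof -
  have "T \<subseteq> S \<Longrightarrow> \<exists>z \<in> S. \<forall>x \<in> T. r x z" if "finite T" for T
    using that
  proof (induction T)
    case empty
    then show ?case using \<open>S \<noteq> {}\<close> by blast
  next
    case (insert t T)
    then obtain z where "z \<in> S" "\<forall>x \<in> T. r x z" by blast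
    then show ?case using directed[of t z] insert.prems trans by blast
  qed
  then show ?thesis using \<open>finite S\<close> by blast
qed

text \<open>The equitable refinements of \<open>P\<close> form a finite set, nonempty because of the
  partition into singletons and directed because of \<open>equitable_join\<close>. So there is a
  coarsest one; antisymmetry makes it unique, which justifies the definite description.\<close>

lemma coarsest_equitable:
  assumes P: "partition_on W P" and "finite W"
  shows "refines W (coarsest_equitable W E P) P" "equitable E (coarsest_equitable W E P)"
    and "refines W Q P \<Longrightarrow> equitable E Q \<Longrightarrow> refines W Q (coarsest_equitable W E P)"
proof -
  let ?S = "{Q. refines W Q P \<and> equitable E Q}"
  let ?C = "\<lambda>Q. refines W Q P \<and> equitable E Q \<and>
    (\<forall>Q'. refines W Q' P \<and> equitable E Q' \<longrightarrow> refines W Q' Q)"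
  have "\<exists>Q \<in> ?S. \<forall>Q' \<in> ?S. refines W Q' Q"
  proof (rule finite_directed_has_greatest)
    have "?S \<subseteq> {Q. partition_on W Q}" by (auto simp: refines_def)
    then show "finite ?S"
      using finitely_many_partition_on[OF \<open>finite W\<close>] by (rule finite_subset)
    have "(\<lambda>x. {x}) ` W \<in> ?S"
      using partition_onD1[OF P] P
      by (auto simp: refines_def partition_on_singletons equitable_singletons)
    then show "?S \<noteq> {}" by blast
    show "refines W Q1 Q3" if "refines W Q1 Q2" "refines W Q2 Q3" for Q1 Q2 Q3
      using that by (rule refines_trans)
    fix Q1 Q2 assume Q: "Q1 \<in> ?S" "Q2 \<in> ?S"
    then have part: "partition_on W Q1" "partition_on W Q2" by (simp_all add: refines_def)
    show "\<exists>Q \<in> ?S. refines W Q1 Q \<and> refines W Q2 Q"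
    proof (intro bexI conjI)
      show "Q1 \<squnion>\<^bsub>partition_order W\<^esub> Q2 \<in> ?S"
        using Q part partition_join(3)[OF part] equitable_join[OF part(1) _ part(2) _ \<open>finite W\<close>]
        by blast
    qed (rule partition_join[OF part])+
  qed
  then obtain R where R: "?C R" by auto
  moreover have "Q' = R" if "?C Q'" for Q'
    by (rule refines_asym[of W]) (use that R in simp_all)
  ultimately have *: "?C (coarsest_equitable W E P)"
    unfolding coarsest_equitable_def by (rule theI)
  show "refines W (coarsest_equitable W E P) P" using * by (rule conjunct1)
  show "equitable E (coarsest_equitable W E P)" using * by blast
  show "refines W Q P \<Longrightarrow> equitable E Q \<Longrightarrow> refines W Q (coarsest_equitable W E P)"
    using * by blast
qed


section \<open>Coloured graphs as pairs of partitions\<close>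

text \<open>\<open>{}\<close> serves as a label for the class of pairs that are constrained to have entry zero, so that
  the order on coloured graphs turns into the refinement order.\<close>

definition zero_partition :: "'v cgraph \<Rightarrow> 'v set set set"
  where "zero_partition G = insert (insert {} ({e. card e = 2} - edges G)) (eclasses G)"

abbreviation edge_labels :: "'v set set"
  where "edge_labels \<equiv> insert {} {e. card e = 2}"

lemma eclasses_card:
  assumes "G \<in> coloured_graphs" "u \<in> eclasses G" "e \<in> u"
  shows "card e = 2"
  using assms by (auto simp: coloured_graphs_iff edges_def)

text \<open>The label \<open>{}\<close> keeps the zero class nonempty when every pair is an edge,
  and it lies in no edge class because edges have two elements.\<close>

lemma partition_on_zero_partition:
  assumes G: "G \<in> coloured_graphs"
  shows "partition_on edge_labels (zero_partition G)"
proof (rule partition_onI)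
  show "\<Union> (zero_partition G) = edge_labels"
    using eclasses_card[OF G] by (auto simp: zero_partition_def edges_def)
  show "{} \<notin> zero_partition G"
    using G partition_onD3 by (auto simp: zero_partition_def coloured_graphs_iff)
  have *: "disjnt u (insert {} ({e. card e = 2} - edges G))" if "u \<in> eclasses G" for u
    using that eclasses_card[OF G that, of "{}"] by (auto simp: disjnt_def edges_def)
  show "disjnt p q" if "p \<in> zero_partition G" "q \<in> zero_partition G" "p \<noteq> q" for p q
    using that * G disjointD[OF partition_onD2, of "edges G" "eclasses G" p q] disjnt_sym
    unfolding zero_partition_def coloured_graphs_iff disjnt_def by blast
qed

text \<open>Inclusion of the zero class of \<open>H\<close> in that of \<open>G\<close> is inclusion
  of the edge set of \<open>G\<close> in that of \<open>H\<close>; an edge class of \<open>H\<close>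
  must lie in an edge class of \<open>G\<close> or among the non-edges of \<open>G\<close>. So the
  encoding reverses the order.\<close>

lemma cgraph_le_iff_refines:
  assumes G: "G \<in> coloured_graphs" and H: "H \<in> coloured_graphs"
  shows "cgraph_le G H \<longleftrightarrow> refines UNIV (vclasses H) (vclasses G) \<and>
    refines edge_labels (zero_partition H) (zero_partition G)"
proof -
  let ?z = "\<lambda>G. insert {} ({e. card e = 2} - edges G)"
  note pG = partition_on_zero_partition[OF G] and pH = partition_on_zero_partition[OF H]
  have eH: "partition_on (edges H) (eclasses H)" using H by (simp add: coloured_graphs_iff)
  have sub: "edges X \<subseteq> {e. card e = 2}" if "X \<in> coloured_graphs" for X :: "'a cgraph"
    using that by (simp add: coloured_graphs_iff)
  have "refines edge_labels (zero_partition H) (zero_partition G) \<longleftrightarrow>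
    edges G \<subseteq> edges H \<and> (\<forall>u \<in> eclasses G. \<exists>U \<subseteq> eclasses H. u = \<Union> U)" (is "?l \<longleftrightarrow> ?r")
  proof
    assume l: ?l
    have "\<exists>q \<in> zero_partition G. ?z H \<subseteq> q"
      using l by (simp add: refines_def zero_partition_def)
    then obtain q where q: "q \<in> zero_partition G" "?z H \<subseteq> q" by blast
    \<comment> \<open>\<open>{}\<close> lies in the zero class of both graphs and thereby identifies
      \<open>q\<close>.\<close>
    have "q = ?z G"
      by (rule partition_on_class_unique[OF pG q(1), of _ "{}"])
        (use q in \<open>auto simp: zero_partition_def\<close>)
    then have "?z H \<subseteq> ?z G" using q(2) by simp
    moreover have "{} \<notin> edges G" using sub[OF G] by fastforce
    ultimately have le: "edges G \<subseteq> edges H" using sub[OF G] by blast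
    have "\<exists>U \<subseteq> eclasses H. u = \<Union> U" if u: "u \<in> eclasses G" for u
      unfolding cup_of_classes_iff[OF eH]
    proof (intro conjI ballI impI)
      show "u \<subseteq> edges H" using u le by (auto simp: edges_def)
      fix p assume p: "p \<in> eclasses H" "p \<inter> u \<noteq> {}"
      have "\<exists>q \<in> zero_partition G. p \<subseteq> q"
        using l p(1) by (simp add: refines_def zero_partition_def)
      then obtain q where q: "q \<in> zero_partition G" "p \<subseteq> q" by blast
      moreover have "u \<in> zero_partition G" using u by (simp add: zero_partition_def)
      ultimately have "q = u" using p(2) partition_on_class_unique[OF pG] by blast
      then show "p \<subseteq> u" using q by simp
    qed
    then show ?r using le by blast
  next
    assume r: ?r
    have "\<exists>q \<in> zero_partition G. p \<subseteq> q" if p: "p \<in> zero_partition H" for p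
    proof (cases "p = ?z H")
      case True
      then have "p \<subseteq> ?z G" using r by blast
      then show ?thesis by (auto simp: zero_partition_def)
    next
      case False
      then have p: "p \<in> eclasses H" using p by (simp add: zero_partition_def)
      show ?thesis
      proof (cases "p \<inter> edges G = {}")
        case True
        then have "p \<subseteq> ?z G" using eclasses_card[OF H p] by blast
        then show ?thesis by (auto simp: zero_partition_def)
      next
        case False
        then obtain u where u: "u \<in> eclasses G" "p \<inter> u \<noteq> {}" by (auto simp: edges_def)
        then have "p \<subseteq> u" using r p unfolding cup_of_classes_iff[OF eH] by blast
        then show ?thesis using u by (auto simp: zero_partition_def)
      qed
    qed
    then show ?l using pG pH by (simp add: refines_def)
  qed
  then show ?thesis unfolding cgraph_le_def by blast
qed

text \<open>Inverts the encoding: the class containing \<open>{}\<close> is the zero class, the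
  others are the edge classes. Together with \<open>cgraph_le_iff_refines\<close> this carries joins
  and meets of partitions over to coloured graphs.\<close>

lemma obtain_cgraph:
  fixes P :: "'v::finite set set set"
  assumes V: "partition_on UNIV V" and P: "partition_on edge_labels P"
  obtains G where "G \<in> coloured_graphs" "vclasses G = V" "zero_partition G = P"
proof
  let ?G = "(V, {p \<in> P. {} \<notin> p})"
  have UP: "\<Union> P = edge_labels" using partition_onD1[OF P] by simp
  have sub: "p \<subseteq> edge_labels" if "p \<in> P" for p using Union_upper[OF that] UP by simp
  have "{} \<in> \<Union> P" using UP by simp
  then obtain z where z: "z \<in> P" "{} \<in> z" by blast
  have zu: "p = z" if "p \<in> P" "{} \<in> p" for p
    using partition_on_class_unique[OF P that(1) z(1) that(2) z(2)] .
  have dj: "p \<inter> z = {}" if "p \<in> P" "{} \<notin> p" for p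
    using partition_on_class_unique[OF P that(1) z(1)] that(2) z(2) by blast
  have E: "edges ?G = {e. card e = 2} - z"
  proof
    show "edges ?G \<subseteq> {e. card e = 2} - z"
    proof
      fix e assume "e \<in> edges ?G"
      then obtain p where "p \<in> P" "{} \<notin> p" "e \<in> p" by (auto simp: edges_def)
      then have "e \<in> edge_labels" "e \<notin> z" "e \<noteq> {}" using dj[of p] sub[of p] z by auto
      then show "e \<in> {e. card e = 2} - z" by simp
    qed
    show "{e. card e = 2} - z \<subseteq> edges ?G"
    proof
      fix e :: "'v set" assume e: "e \<in> {e. card e = 2} - z"
      then have "e \<in> \<Union> P" using UP by simp
      then obtain p where "p \<in> P" "e \<in> p" by blast
      then show "e \<in> edges ?G" using zu e by (auto simp: edges_def)
    qed
  qed
  have "insert {} ({e. card e = 2} - edges ?G) = z" using z E sub[OF z(1)] by auto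
  then have "zero_partition ?G = insert z {p \<in> P. {} \<notin> p}" by (simp add: zero_partition_def)
  also have "\<dots> = P"
  proof
    show "insert z {p \<in> P. {} \<notin> p} \<subseteq> P" using z by simp
    show "P \<subseteq> insert z {p \<in> P. {} \<notin> p}"
    proof
      fix p assume "p \<in> P"
      then show "p \<in> insert z {p \<in> P. {} \<notin> p}" using zu[of p] by fast
    qed
  qed
  finally show "zero_partition ?G = P" .
  have "partition_on (edges ?G) (eclasses ?G)"
    using partition_on_subset[OF P, of "{p \<in> P. {} \<notin> p}"] by (simp add: edges_def)
  then show "?G \<in> coloured_graphs" using V E by (auto simp: coloured_graphs_iff)
qed simp

section \<open>Meets and joins of coloured graphs\<close>

lemma cgraph_meet_greatest:
  assumes G: "G \<in> coloured_graphs" and H: "H \<in> coloured_graphs"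
  shows "G \<sqinter>\<^bsub>cgraph_order\<^esub> H \<in> coloured_graphs"
    and "cgraph_le (G \<sqinter>\<^bsub>cgraph_order\<^esub> H) G" "cgraph_le (G \<sqinter>\<^bsub>cgraph_order\<^esub> H) H"
    and "\<And>K. K \<in> coloured_graphs \<Longrightarrow> cgraph_le K G \<Longrightarrow> cgraph_le K H \<Longrightarrow>
      cgraph_le K (G \<sqinter>\<^bsub>cgraph_order\<^esub> H)"
proof -
  note pG = partition_on_zero_partition[OF G] and pH = partition_on_zero_partition[OF H]
  have vG: "partition_on UNIV (vclasses G)" and vH: "partition_on UNIV (vclasses H)"
    using G H by (simp_all add: coloured_graphs_iff)
  note V = partition_join[OF vG vH] and E = partition_join[OF pG pH]
  \<comment> \<open>As the encoding reverses the order, joins of partitions yield the meet of the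
    graphs.\<close>
  obtain M where M: "M \<in> coloured_graphs" "vclasses M = vclasses G \<squnion>\<^bsub>partition_order UNIV\<^esub> vclasses H"
    "zero_partition M = zero_partition G \<squnion>\<^bsub>partition_order edge_labels\<^esub> zero_partition H"
    using obtain_cgraph V(1) E(1) unfolding refines_def by metis
  have *: "cgraph_le M G" "cgraph_le M H"
    "\<And>K. K \<in> coloured_graphs \<Longrightarrow> cgraph_le K G \<Longrightarrow> cgraph_le K H \<Longrightarrow> cgraph_le K M"
    using M(1) G H V E by (simp_all add: cgraph_le_iff_refines M(2,3))
  then have "G \<sqinter>\<^bsub>cgraph_order\<^esub> H = M" by (intro cgraph_meet_eqI G H M(1))
  then show "G \<sqinter>\<^bsub>cgraph_order\<^esub> H \<in> coloured_graphs"
    and "cgraph_le (G \<sqinter>\<^bsub>cgraph_order\<^esub> H) G" "cgraph_le (G \<sqinter>\<^bsub>cgraph_order\<^esub> H) H"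
    and "\<And>K. K \<in> coloured_graphs \<Longrightarrow> cgraph_le K G \<Longrightarrow> cgraph_le K H \<Longrightarrow>
      cgraph_le K (G \<sqinter>\<^bsub>cgraph_order\<^esub> H)"
    using * M(1) by simp_all
qed

lemma cgraph_join_least:
  assumes G: "G \<in> coloured_graphs" and H: "H \<in> coloured_graphs"
  shows "G \<squnion>\<^bsub>cgraph_order\<^esub> H \<in> coloured_graphs"
    and "cgraph_le G (G \<squnion>\<^bsub>cgraph_order\<^esub> H)" "cgraph_le H (G \<squnion>\<^bsub>cgraph_order\<^esub> H)"
    and "\<And>K. K \<in> coloured_graphs \<Longrightarrow> cgraph_le G K \<Longrightarrow> cgraph_le H K \<Longrightarrow>
      cgraph_le (G \<squnion>\<^bsub>cgraph_order\<^esub> H) K"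
proof -
  note pG = partition_on_zero_partition[OF G] and pH = partition_on_zero_partition[OF H]
  have vG: "partition_on UNIV (vclasses G)" and vH: "partition_on UNIV (vclasses H)"
    using G H by (simp_all add: coloured_graphs_iff)
  note V = partition_meet[OF vG vH] and E = partition_meet[OF pG pH]
  \<comment> \<open>Dually, meets of partitions yield the join of the graphs.\<close>
  obtain J where J: "J \<in> coloured_graphs" "vclasses J = vclasses G \<sqinter>\<^bsub>partition_order UNIV\<^esub> vclasses H"
    "zero_partition J = zero_partition G \<sqinter>\<^bsub>partition_order edge_labels\<^esub> zero_partition H"
    using obtain_cgraph V(1) E(1) unfolding refines_def by metis
  have *: "cgraph_le G J" "cgraph_le H J"
    "\<And>K. K \<in> coloured_graphs \<Longrightarrow> cgraph_le G K \<Longrightarrow> cgraph_le H K \<Longrightarrow> cgraph_le J K"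
    using J(1) G H V E by (simp_all add: cgraph_le_iff_refines J(2,3))
  then have "G \<squnion>\<^bsub>cgraph_order\<^esub> H = J" by (intro cgraph_join_eqI G H J(1))
  then show "G \<squnion>\<^bsub>cgraph_order\<^esub> H \<in> coloured_graphs"
    and "cgraph_le G (G \<squnion>\<^bsub>cgraph_order\<^esub> H)" "cgraph_le H (G \<squnion>\<^bsub>cgraph_order\<^esub> H)"
    and "\<And>K. K \<in> coloured_graphs \<Longrightarrow> cgraph_le G K \<Longrightarrow> cgraph_le H K \<Longrightarrow>
      cgraph_le (G \<squnion>\<^bsub>cgraph_order\<^esub> H) K"
    using * J(1) by simp_all
qed

text \<open>Edge classes of \<open>J\<close> are disjoint unions of edge classes of
  \<open>K\<close>, so \<open>equitable_Union\<close> applies. Needed for meets, where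
  \<open>J\<close> is the meet, and for the minimality of \<open>s_P J\<close>.\<close>

lemma vertex_regular_equitable_classes:
  fixes J K :: "'v::finite cgraph"
  assumes K: "K \<in> vertex_regular_graphs" and le: "cgraph_le J K" and u: "u \<in> eclasses J"
  shows "equitable u (vclasses K)"
proof -
  obtain U where U: "U \<subseteq> eclasses K" "u = \<Union> U" using cgraph_le_classes[OF le u] by blast
  have eK: "partition_on (edges K) (eclasses K)"
    using K by (simp add: vertex_regular_graphs_def coloured_graphs_iff)
  show ?thesis
    unfolding U(2)
  proof (rule equitable_Union)
    show "disjoint U" using partition_onD2[OF eK] U(1) by (rule pairwise_subset)
    show "equitable s (vclasses K)" if "s \<in> U" for s
      using K U(1) that by (auto simp: vertex_regular_graphs_def vertex_regular_def)
  qed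
qed


section \<open>Equitable refinement in the factor graph\<close>

text \<open>Has the shape of \<open>factor_partition\<close>, but for arbitrary partitions of the
  two sides, so that finer partitions of the factor graph can be written with it.\<close>

definition sum_partition :: "'a set set \<Rightarrow> 'b set set \<Rightarrow> ('a + 'b) set set"
  where "sum_partition P Q = (`) Inl ` P \<union> (`) Inr ` Q"

lemma sum_partitionE:
  assumes "p \<in> sum_partition P Q"
  obtains x where "x \<in> P" "p = Inl ` x" | y where "y \<in> Q" "p = Inr ` y"
  using assms by (auto simp: sum_partition_def)

lemma partition_on_sum_partition:
  assumes P: "partition_on A P" and Q: "partition_on B Q"
  shows "partition_on (Inl ` A \<union> Inr ` B) (sum_partition P Q)"
proof (rule partition_onI)
  have "\<Union> (sum_partition P Q) = Inl ` \<Union> P \<union> Inr ` \<Union> Q"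
    by (auto simp: sum_partition_def)
  then show "\<Union> (sum_partition P Q) = Inl ` A \<union> Inr ` B"
    using partition_onD1[OF P] partition_onD1[OF Q] by simp
  show "{} \<notin> sum_partition P Q"
    using partition_onD3[OF P] partition_onD3[OF Q] by (auto simp: sum_partition_def)
  fix p q assume p: "p \<in> sum_partition P Q" and q: "q \<in> sum_partition P Q" and "p \<noteq> q"
  have "p = q" if z: "z \<in> p" "z \<in> q" for z
  proof (cases z)
    case (Inl x)
    obtain v where v: "v \<in> P" "p = Inl ` v" using p z Inl by (auto simp: sum_partition_def)
    obtain w where w: "w \<in> P" "q = Inl ` w" using q z Inl by (auto simp: sum_partition_def)
    have "x \<in> v" "x \<in> w" using z Inl v w by auto
    then show ?thesis using v w partition_on_class_unique[OF P, of v w x] by simp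
  next
    case (Inr y)
    obtain v where v: "v \<in> Q" "p = Inr ` v" using p z Inr by (auto simp: sum_partition_def)
    obtain w where w: "w \<in> Q" "q = Inr ` w" using q z Inr by (auto simp: sum_partition_def)
    have "y \<in> v" "y \<in> w" using z Inr v w by auto
    then show ?thesis using v w partition_on_class_unique[OF Q, of v w y] by simp
  qed
  then show "disjnt p q" using \<open>p \<noteq> q\<close> unfolding disjnt_iff by blast
qed

lemma refines_sum_partition:
  assumes "refines A P P'" "refines B Q Q'"
  shows "refines (Inl ` A \<union> Inr ` B) (sum_partition P Q) (sum_partition P' Q')"
proof -
  have "\<exists>q \<in> sum_partition P' Q'. p \<subseteq> q" if p: "p \<in> sum_partition P Q" for p
  proof -
    show ?thesis
      using p
    proof (cases rule: sum_partitionE)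
      case (1 x)
      then obtain x' where "x' \<in> P'" "x \<subseteq> x'" using assms by (auto simp: refines_def)
      then have "Inl ` x' \<in> sum_partition P' Q'" "p \<subseteq> Inl ` x'"
        using 1 by (auto simp: sum_partition_def)
      then show ?thesis ..
    next
      case (2 y)
      then obtain y' where "y' \<in> Q'" "y \<subseteq> y'" using assms by (auto simp: refines_def)
      then have "Inr ` y' \<in> sum_partition P' Q'" "p \<subseteq> Inr ` y'"
        using 2 by (auto simp: sum_partition_def)
      then show ?thesis ..
    qed
  qed
  then show ?thesis
    using assms partition_on_sum_partition[of A P B Q] partition_on_sum_partition[of A P' B Q']
    by (simp add: refines_def)
qed

lemma neighbours_factor_edges:
  "neighbours (factor_edges G) (Inl \<alpha>) = Inr ` {e \<in> edges G. \<alpha> \<in> e}"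
  "e \<in> edges G \<Longrightarrow> neighbours (factor_edges G) (Inr e) = Inl ` e"
  by (auto simp: neighbours_def factor_edges_def doubleton_eq_iff)

text \<open>Neighbours of \<open>\<alpha>\<close> correspond to edges at \<open>\<alpha>\<close>
  through \<open>\<lambda>x. {\<alpha>, x}\<close>, which is onto because edges have two elements.
  The predicate \<open>R\<close> restricts the count to edges of a given type.\<close>

lemma card_incident_edges:
  fixes u :: "'v::finite set set"
  assumes u: "\<And>e. e \<in> u \<Longrightarrow> card e = 2"
  shows "card {e \<in> u. \<alpha> \<in> e \<and> R e} = card {x \<in> neighbours u \<alpha>. R {\<alpha>, x}}"
proof (rule bij_betw_same_card[symmetric], rule bij_betw_imageI)
  show "inj_on (\<lambda>x. {\<alpha>, x}) {x \<in> neighbours u \<alpha>. R {\<alpha>, x}}"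
    by (auto simp: inj_on_def doubleton_eq_iff)
  have "\<exists>x. e = {\<alpha>, x}" if "e \<in> u" "\<alpha> \<in> e" for e
    using u[OF that(1)] that(2) by (auto simp: card_2_iff)
  then show "(\<lambda>x. {\<alpha>, x}) ` {x \<in> neighbours u \<alpha>. R {\<alpha>, x}} = {e \<in> u. \<alpha> \<in> e \<and> R e}"
    by (fastforce simp: neighbours_def)
qed

lemma card_pair_Int:
  "\<alpha> \<noteq> x \<Longrightarrow> card ({\<alpha>, x} \<inter> w) = (if \<alpha> \<in> w then 1 else 0) + (if x \<in> w then 1 else 0)"
  by (auto simp: Int_insert_left)

section \<open>The operator \<open>s_P\<close> on a fixed coloured graph\<close>

context
  fixes J :: "'v::finite cgraph"
  assumes J: "J \<in> coloured_graphs"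
begin

lemma vclasses_partition: "partition_on UNIV (vclasses J)"
  and eclasses_partition: "partition_on (edges J) (eclasses J)"
  using J by (simp_all add: coloured_graphs_iff)

lemma factor_partition_eq: "factor_partition J = sum_partition (vclasses J) (eclasses J)"
  by (simp add: factor_partition_def sum_partition_def)

lemma factor_refinement:
  shows "refines (factor_nodes J) (factor_refinement J) (factor_partition J)"
    and "equitable (factor_edges J) (factor_refinement J)"
    and "refines (factor_nodes J) Q (factor_partition J) \<Longrightarrow> equitable (factor_edges J) Q \<Longrightarrow>
      refines (factor_nodes J) Q (factor_refinement J)"
proof -
  have "partition_on (factor_nodes J) (factor_partition J)"
    unfolding factor_nodes_def factor_partition_eq
    by (rule partition_on_sum_partition[OF vclasses_partition eclasses_partition])
  note * = coarsest_equitable[OF this finite]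
  show "refines (factor_nodes J) (factor_refinement J) (factor_partition J)"
    and "equitable (factor_edges J) (factor_refinement J)"
    and "refines (factor_nodes J) Q (factor_partition J) \<Longrightarrow> equitable (factor_edges J) Q \<Longrightarrow>
      refines (factor_nodes J) Q (factor_refinement J)"
    unfolding factor_refinement_def by (rule *; assumption?)+
qed

lemma factor_refinement_partition: "partition_on (factor_nodes J) (factor_refinement J)"
  using factor_refinement(1) by (simp add: refines_def)

text \<open>Being finer than \<open>factor_partition\<close>, the refinement never mixes vertices
  with edge nodes in a class.\<close>

lemma factor_refinement_class_cases:
  assumes "q \<in> factor_refinement J"
  obtains v where "v \<in> vclasses J" "q \<subseteq> Inl ` v" | u where "u \<in> eclasses J" "q \<subseteq> Inr ` u"
proof -
  obtain p where "p \<in> factor_partition J" "q \<subseteq> p"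
    using factor_refinement(1) assms by (auto simp: refines_def)
  then show thesis using that by (auto simp: factor_partition_def)
qed

lemma eclasses_s_P: "eclasses (s_P J) = eclasses J" "edges (s_P J) = edges J"
  by (simp_all add: s_P_def edges_def)

lemma vclasses_s_P_iff: "v \<in> vclasses (s_P J) \<longleftrightarrow> Inl ` v \<in> factor_refinement J"
  by (simp add: s_P_def)

text \<open>The class of a vertex consists of vertices only, so it is the image of its preimage
  under \<open>Inl\<close>.\<close>

lemma vertex_class_in_s_P:
  assumes q: "q \<in> factor_refinement J" "Inl \<alpha> \<in> q"
  obtains w v where "q = Inl ` w" "w \<in> vclasses (s_P J)" "w \<subseteq> v" "v \<in> vclasses J" "\<alpha> \<in> w"
proof -
  obtain v where v: "v \<in> vclasses J" "q \<subseteq> Inl ` v"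
    using q by (cases rule: factor_refinement_class_cases[OF q(1)]) auto
  define w where "w = Inl -` q"
  have w: "q = Inl ` w" using v unfolding w_def by blast
  show thesis
  proof
    show "w \<in> vclasses (s_P J)" using q(1) w vclasses_s_P_iff by simp
    show "w \<subseteq> v" using v(2) w by auto
    show "\<alpha> \<in> w" using q(2) by (simp add: w_def)
  qed (use w v in auto)
qed

lemma refines_vclasses_s_P: "refines UNIV (vclasses (s_P J)) (vclasses J)"
proof -
  have cover: "\<exists>w. \<alpha> \<in> w \<and> w \<in> vclasses (s_P J)" for \<alpha>
  proof -
    have "Inl \<alpha> \<in> \<Union> (factor_refinement J)"
      unfolding partition_onD1[OF factor_refinement_partition, symmetric]
      by (simp add: factor_nodes_def)
    then obtain q where q: "q \<in> factor_refinement J" "Inl \<alpha> \<in> q" by blast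
    then show ?thesis by (rule vertex_class_in_s_P) blast
  qed
  have ne: "{} \<notin> vclasses (s_P J)"
    using partition_onD3[OF factor_refinement_partition] by (simp add: vclasses_s_P_iff)
  have "partition_on UNIV (vclasses (s_P J))"
  proof (rule partition_onI)
    show "\<Union> (vclasses (s_P J)) = UNIV" using cover by auto
    fix v w assume vw: "v \<in> vclasses (s_P J)" "w \<in> vclasses (s_P J)" "v \<noteq> w"
    then have "Inl ` v \<inter> (Inl ` w :: ('v + 'v set) set) = {}"
      using disjointD[OF partition_onD2[OF factor_refinement_partition], of "Inl ` v" "Inl ` w"]
      by (simp add: vclasses_s_P_iff inj_image_eq_iff)
    then show "disjnt v w" by (simp add: disjnt_def image_Int[symmetric])
  qed (rule ne)
  moreover have "\<exists>v \<in> vclasses J. w \<subseteq> v" if "w \<in> vclasses (s_P J)" for w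
  proof -
    have q: "Inl ` w \<in> factor_refinement J" using that by (simp add: vclasses_s_P_iff)
    have "w \<noteq> {}" using that ne by blast
    then obtain \<alpha> where "\<alpha> \<in> w" by blast
    then have "Inl \<alpha> \<in> (Inl ` w :: ('v + 'v set) set)" by simp
    from vertex_class_in_s_P[OF q this] show ?thesis by (metis inj_Inl inj_image_eq_iff)
  qed
  ultimately show ?thesis using vclasses_partition by (simp add: refines_def)
qed

text \<open>For an edge \<open>e\<close> at \<open>\<alpha>\<close> the other end lies in \<open>w\<close> iff \<open>e\<close> meets \<open>w\<close> in \<open>k\<close> vertices, where
  \<open>k = 2\<close> if \<open>\<alpha> \<in> w\<close> and \<open>k = 1\<close> otherwise. Equitability at the edge nodes makes the set of edges
  meeting \<open>w\<close> in \<open>k\<close> vertices a union of classes.\<close>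

lemma vertex_regular_s_P: "vertex_regular (s_P J)"
  unfolding vertex_regular_def equitable_def eclasses_s_P
proof (intro ballI)
  let ?Q = "factor_refinement J"
  fix u v w \<alpha> \<beta>
  assume u: "u \<in> eclasses J" and v: "v \<in> vclasses (s_P J)" and w: "w \<in> vclasses (s_P J)"
    and \<alpha>: "\<alpha> \<in> v" and \<beta>: "\<beta> \<in> v"
  \<comment> \<open>Phrased with \<open>v = w\<close> so that \<open>k\<close> is the same for all
    vertices of \<open>v\<close>; as classes are disjoint, this is equivalent to any one vertex of
    \<open>v\<close> lying in \<open>w\<close>.\<close>
  define k :: nat where "k = (if v = w then 2 else 1)"
  define S where "S = {q \<in> ?Q. q \<subseteq> Inr ` {e \<in> u. card (e \<inter> w) = k}}"
  have vQ: "Inl ` v \<in> ?Q" and wQ: "Inl ` w \<in> ?Q" using v w by (simp_all add: vclasses_s_P_iff)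
  have uE: "u \<subseteq> edges J" using u by (auto simp: edges_def)
  have S: "\<Union> S = Inr ` {e \<in> u. card (e \<inter> w) = k}"
  proof
    show "\<Union> S \<subseteq> Inr ` {e \<in> u. card (e \<inter> w) = k}" by (auto simp: S_def)
    show "Inr ` {e \<in> u. card (e \<inter> w) = k} \<subseteq> \<Union> S"
    proof clarify
      fix e assume e: "e \<in> u" and k: "k = card (e \<inter> w)"
      have "Inr e \<in> \<Union> ?Q"
        unfolding partition_onD1[OF factor_refinement_partition, symmetric]
        using e uE by (auto simp: factor_nodes_def)
      then obtain q where q: "q \<in> ?Q" "Inr e \<in> q" by blast
      then obtain u' where u': "u' \<in> eclasses J" "q \<subseteq> Inr ` u'"
        by (cases rule: factor_refinement_class_cases[OF q(1)]) auto
      have "u' = u"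
        by (rule partition_on_class_unique[OF eclasses_partition u'(1) u, of e]) (use q u' e in auto)
      \<comment> \<open>The neighbours of an edge node are its two ends, so equitability towards the
        class given by \<open>w\<close> fixes the number of ends in \<open>w\<close> throughout
        \<open>q\<close>.\<close>
      have "card (f \<inter> w) = card (e \<inter> w)" if f: "Inr f \<in> q" for f
      proof -
        have "f \<in> edges J" "e \<in> edges J" using f u' \<open>u' = u\<close> uE e by auto
        moreover have "card (neighbours (factor_edges J) (Inr f) \<inter> Inl ` w) =
            card (neighbours (factor_edges J) (Inr e) \<inter> Inl ` w)"
          using factor_refinement(2) q wQ f unfolding equitable_def by blast
        ultimately show ?thesis
          by (simp add: neighbours_factor_edges image_Int[symmetric] card_image)
      qed
      then have "q \<subseteq> Inr ` {e \<in> u. card (e \<inter> w) = k}" using u' \<open>u' = u\<close> k by auto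
      then show "Inr e \<in> \<Union> S" using q by (auto simp: S_def)
    qed
  qed
  have count: "card (neighbours u \<gamma> \<inter> w) = card (neighbours (factor_edges J) (Inl \<gamma>) \<inter> \<Union> S)"
    if \<gamma>: "\<gamma> \<in> v" for \<gamma>
  proof -
    have vw: "\<gamma> \<in> w \<longleftrightarrow> v = w"
      using partition_on_class_unique[OF _ v w \<gamma>] \<gamma> refines_vclasses_s_P by (auto simp: refines_def)
    have "x \<in> w \<longleftrightarrow> card ({\<gamma>, x} \<inter> w) = k" if "x \<in> neighbours u \<gamma>" for x
    proof -
      have "\<gamma> \<noteq> x" using eclasses_card[OF J u, of "{\<gamma>, x}"] that by (auto simp: neighbours_def)
      then show ?thesis using vw by (simp add: card_pair_Int k_def)
    qed
    then have "neighbours u \<gamma> \<inter> w = {x \<in> neighbours u \<gamma>. card ({\<gamma>, x} \<inter> w) = k}" by auto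
    also have "card \<dots> = card {e \<in> u. \<gamma> \<in> e \<and> card (e \<inter> w) = k}"
      by (rule card_incident_edges[symmetric]) (rule eclasses_card[OF J u])
    also have "\<dots> = card (Inr ` {e \<in> u. \<gamma> \<in> e \<and> card (e \<inter> w) = k} :: ('v + 'v set) set)"
      by (simp add: card_image)
    also have "Inr ` {e \<in> u. \<gamma> \<in> e \<and> card (e \<inter> w) = k} = neighbours (factor_edges J) (Inl \<gamma>) \<inter> \<Union> S"
      unfolding S neighbours_factor_edges using uE by auto
    finally show ?thesis .
  qed
  have "card (neighbours (factor_edges J) (Inl \<alpha>) \<inter> \<Union> S) =
      card (neighbours (factor_edges J) (Inl \<beta>) \<inter> \<Union> S)"
    by (rule card_neighbours_cup[OF factor_refinement_partition finite factor_refinement(2) _ vQ])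
      (use \<alpha> \<beta> in \<open>auto simp: S_def\<close>)
  then show "card (neighbours u \<alpha> \<inter> w) = card (neighbours u \<beta> \<inter> w)"
    using count \<alpha> \<beta> by simp
qed

text \<open>A partition that is equitable for all edge classes extends to an equitable partition of the
  factor graph: subdivide every edge class according to the vertex classes of the two ends.\<close>

lemma refines_vclasses_s_P_greatest:
  assumes P: "refines UNIV P (vclasses J)" and eq: "\<And>u. u \<in> eclasses J \<Longrightarrow> equitable u P"
  shows "refines UNIV P (vclasses (s_P J))"
proof -
  \<comment> \<open>The profile of an edge: how many of its ends lie in each class of
    \<open>P\<close>. The value 0 off \<open>P\<close> makes equality of profiles a statement about
    classes only.\<close>
  define \<tau> where "\<tau> e w = (if w \<in> P then card (e \<inter> w) else 0)" for e w
  \<comment> \<open>The set of edge classes containing \<open>e\<close> is a singleton, so agreement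
    in the first component means lying in the same edge class.\<close>
  define N where "N = level_sets (edges J) (\<lambda>e. ({u \<in> eclasses J. e \<in> u}, \<tau> e))"
  have pP: "partition_on UNIV P" using P by (simp add: refines_def)
  have N_cases: "\<exists>u \<in> eclasses J. \<exists>g. t = {e \<in> u. \<tau> e = \<tau> g}" if t: "t \<in> N" for t
  proof -
    obtain g where g: "g \<in> edges J"
        "t = {e \<in> edges J. {u \<in> eclasses J. e \<in> u} = {u \<in> eclasses J. g \<in> u} \<and> \<tau> e = \<tau> g}"
      using t by (auto simp: N_def level_sets_def)
    then obtain u where u: "u \<in> eclasses J" "g \<in> u" by (auto simp: edges_def)
    have cl: "{u \<in> eclasses J. e \<in> u} = {u}" if "e \<in> u" for e
      using partition_on_class_unique[OF eclasses_partition _ u(1) _ that] that u(1) by blast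
    have "e \<in> edges J \<and> {u \<in> eclasses J. e \<in> u} = {u} \<longleftrightarrow> e \<in> u" for e
      using cl u(1) by (auto simp: edges_def)
    then have "t = {e \<in> u. \<tau> e = \<tau> g}" unfolding g(2) cl[OF u(2)] by auto
    then show ?thesis using u(1) by blast
  qed
  have "refines (edges J) N (eclasses J)"
    unfolding refines_def
  proof (intro conjI ballI eclasses_partition)
    show "partition_on (edges J) N" unfolding N_def by (rule partition_on_level_sets)
    show "\<exists>u \<in> eclasses J. t \<subseteq> u" if "t \<in> N" for t using N_cases[OF that] by blast
  qed
  then have ref: "refines (factor_nodes J) (sum_partition P N) (factor_partition J)"
    unfolding factor_nodes_def factor_partition_eq by (rule refines_sum_partition[OF P])
  have eq1: "card (neighbours (factor_edges J) (Inl \<alpha>) \<inter> Inr ` t) =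
      card (neighbours (factor_edges J) (Inl \<beta>) \<inter> Inr ` t)"
    if t: "t \<in> N" and v: "v \<in> P" "\<alpha> \<in> v" "\<beta> \<in> v" for t v \<alpha> \<beta>
  proof -
    obtain u g where u: "u \<in> eclasses J" and t: "t = {e \<in> u. \<tau> e = \<tau> g}" using N_cases[OF t] by blast
    have uE: "u \<subseteq> edges J" using u by (auto simp: edges_def)
    \<comment> \<open>The second ends \<open>x\<close> for which an edge from \<open>v\<close> to
      \<open>x\<close> has the profile of \<open>g\<close>. The condition sees \<open>x\<close> only
      through its class, so \<open>X\<close> is a union of classes of \<open>P\<close>.\<close>
    define X where "X = {x. \<forall>w \<in> P. (if v = w then 1 else 0) + (if x \<in> w then 1 else 0) = card (g \<inter> w)}"
    have "p \<subseteq> X" if p: "p \<in> P" "p \<inter> X \<noteq> {}" for p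
    proof
      fix y assume y: "y \<in> p"
      obtain x where x: "x \<in> p" "x \<in> X" using p(2) by blast
      have "x \<in> w \<longleftrightarrow> y \<in> w" if "w \<in> P" for w
        using partition_on_class_unique[OF pP p(1) that] x y by metis
      then show "y \<in> X" using x(2) by (simp add: X_def)
    qed
    then have "\<exists>S \<subseteq> P. X = \<Union> S" unfolding cup_of_classes_iff[OF pP] by blast
    then obtain S where S: "S \<subseteq> P" "X = \<Union> S" by blast
    have count: "card (neighbours (factor_edges J) (Inl \<gamma>) \<inter> Inr ` t) = card (neighbours u \<gamma> \<inter> \<Union> S)"
      if \<gamma>: "\<gamma> \<in> v" for \<gamma>
    proof -
      have "neighbours (factor_edges J) (Inl \<gamma>) \<inter> Inr ` t = Inr ` {e \<in> u. \<gamma> \<in> e \<and> \<tau> e = \<tau> g}"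
        unfolding neighbours_factor_edges t using uE by auto
      then have "card (neighbours (factor_edges J) (Inl \<gamma>) \<inter> Inr ` t) =
          card {e \<in> u. \<gamma> \<in> e \<and> \<tau> e = \<tau> g}"
        by (simp add: card_image)
      also have "\<dots> = card {x \<in> neighbours u \<gamma>. \<tau> {\<gamma>, x} = \<tau> g}"
        by (rule card_incident_edges) (rule eclasses_card[OF J u])
      also have "{x \<in> neighbours u \<gamma>. \<tau> {\<gamma>, x} = \<tau> g} = neighbours u \<gamma> \<inter> X"
      proof -
        have "\<tau> {\<gamma>, x} = \<tau> g \<longleftrightarrow> x \<in> X" if "x \<in> neighbours u \<gamma>" for x
        proof -
          have "\<gamma> \<noteq> x" using eclasses_card[OF J u, of "{\<gamma>, x}"] that by (auto simp: neighbours_def)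
          then have "card ({\<gamma>, x} \<inter> w) = (if v = w then 1 else 0) + (if x \<in> w then 1 else 0)"
            if "w \<in> P" for w
            using partition_on_class_unique[OF pP v(1) that \<gamma>] \<gamma> by (auto simp: card_pair_Int)
          moreover have "\<tau> {\<gamma>, x} = \<tau> g \<longleftrightarrow> (\<forall>w \<in> P. card ({\<gamma>, x} \<inter> w) = card (g \<inter> w))"
            by (auto simp: \<tau>_def fun_eq_iff)
          ultimately show ?thesis by (simp add: X_def)
        qed
        then show ?thesis by blast
      qed
      finally show ?thesis by (simp add: S(2))
    qed
    have "card (neighbours u \<alpha> \<inter> \<Union> S) = card (neighbours u \<beta> \<inter> \<Union> S)"
      by (rule card_neighbours_cup[OF pP finite eq[OF u] S(1) v])
    then show ?thesis using count v by simp
  qed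
  have eq2: "card (neighbours (factor_edges J) (Inr e) \<inter> Inl ` w) =
      card (neighbours (factor_edges J) (Inr f) \<inter> Inl ` w)"
    if t: "t \<in> N" "e \<in> t" "f \<in> t" and w: "w \<in> P" for t w e f
  proof -
    obtain u g where u: "u \<in> eclasses J" "t = {e \<in> u. \<tau> e = \<tau> g}" using N_cases[OF t(1)] by blast
    then have ef: "e \<in> edges J" "f \<in> edges J" "\<tau> e w = \<tau> f w" using t by (auto simp: edges_def)
    then show ?thesis
      using w by (simp add: neighbours_factor_edges \<tau>_def image_Int[symmetric] card_image)
  qed
  have "equitable (factor_edges J) (sum_partition P N)"
    unfolding equitable_def
  proof (intro ballI)
    fix p q x y assume pq: "p \<in> sum_partition P N" "q \<in> sum_partition P N" "x \<in> p" "y \<in> p"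
    have NE: "t \<subseteq> edges J" if "t \<in> N" for t using that by (auto simp: N_def level_sets_def)
    show "card (neighbours (factor_edges J) x \<inter> q) = card (neighbours (factor_edges J) y \<inter> q)"
    \<comment> \<open>The factor graph is bipartite: in the two unmixed cases all counts vanish, and
      the mixed ones are \<open>eq1\<close> and \<open>eq2\<close>.\<close>
    proof (cases rule: sum_partitionE[OF pq(1)]; cases rule: sum_partitionE[OF pq(2)])
      fix v w assume p: "p = Inl ` v" "q = Inl ` w"
      have "neighbours (factor_edges J) z \<inter> q = {}" if "z \<in> p" for z
        using that p by (auto simp: neighbours_factor_edges)
      then show ?thesis using pq by simp
    next
      fix v t assume p: "v \<in> P" "p = Inl ` v" "t \<in> N" "q = Inr ` t"
      obtain \<alpha> \<beta> where xy: "x = Inl \<alpha>" "\<alpha> \<in> v" "y = Inl \<beta>" "\<beta> \<in> v" using pq(3,4) p(2) by auto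
      then show ?thesis using eq1[OF p(3,1) xy(2,4)] p(4) xy(1,3) by simp
    next
      fix t w assume p: "t \<in> N" "p = Inr ` t" "w \<in> P" "q = Inl ` w"
      obtain e f where xy: "x = Inr e" "e \<in> t" "y = Inr f" "f \<in> t" using pq(3,4) p(2) by auto
      then show ?thesis using eq2[OF p(1) xy(2,4) p(3)] p(4) xy(1,3) by simp
    next
      fix t s assume p: "t \<in> N" "p = Inr ` t" "q = Inr ` s"
      have "neighbours (factor_edges J) z \<inter> q = {}" if z: "z \<in> p" for z
      proof -
        obtain e where "e \<in> edges J" "z = Inr e" using z p NE by blast
        then show ?thesis using p by (auto simp: neighbours_factor_edges)
      qed
      then show ?thesis using pq by simp
    qed
  qed
  then have *: "refines (factor_nodes J) (sum_partition P N) (factor_refinement J)"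
    by (rule factor_refinement(3)[OF ref])
  have "\<exists>w \<in> vclasses (s_P J). v \<subseteq> w" if v: "v \<in> P" for v
  proof -
    obtain \<alpha> where \<alpha>: "\<alpha> \<in> v" using partition_on_nonempty[OF pP v] by blast
    have "Inl ` v \<in> sum_partition P N" using v by (simp add: sum_partition_def)
    then obtain q where q: "q \<in> factor_refinement J" "Inl ` v \<subseteq> q"
      using * unfolding refines_def by blast
    then have "Inl \<alpha> \<in> q" using \<alpha> by blast
    then obtain w where "q = Inl ` w" "w \<in> vclasses (s_P J)"
      using vertex_class_in_s_P[OF q(1)] by metis
    then show ?thesis using q(2) by auto
  qed
  then show ?thesis
    using pP refines_vclasses_s_P by (simp add: refines_def)
qed

text \<open>The edge classes stay fixed, so only vertex partitions matter. That of a vertex regular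
  \<open>K\<close> above \<open>J\<close> is equitable for all edge classes of \<open>J\<close>,
  hence finer than that of \<open>s_P J\<close>, the coarsest such refinement.\<close>

lemma s_P_least:
  shows "s_P J \<in> vertex_regular_graphs" "cgraph_le J (s_P J)"
    and "K \<in> vertex_regular_graphs \<Longrightarrow> cgraph_le J K \<Longrightarrow> cgraph_le (s_P J) K"
proof -
  show "s_P J \<in> vertex_regular_graphs"
    using J refines_vclasses_s_P vertex_regular_s_P
    by (auto simp: vertex_regular_graphs_def coloured_graphs_iff eclasses_s_P refines_def)
  show "cgraph_le J (s_P J)"
    using cgraph_le_refl[OF J] refines_vclasses_s_P by (simp add: cgraph_le_def eclasses_s_P)
  assume K: "K \<in> vertex_regular_graphs" and le: "cgraph_le J K"
  have "refines UNIV (vclasses K) (vclasses (s_P J))"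
    using le vertex_regular_equitable_classes[OF K le]
    by (intro refines_vclasses_s_P_greatest) (simp_all add: cgraph_le_def)
  then show "cgraph_le (s_P J) K" using le by (simp add: cgraph_le_def eclasses_s_P)
qed

end


section \<open>The lattice of vertex regular graphs\<close>

text \<open>Edge classes of the meet are unions of edge classes of \<open>G\<close> and of
  \<open>H\<close>, so both vertex partitions are equitable for them. By
  \<open>equitable_join\<close> so is their join, which is the vertex partition of the meet.\<close>

lemma vertex_regular_meet:
  assumes G: "G \<in> vertex_regular_graphs" and H: "H \<in> vertex_regular_graphs"
  shows "G \<sqinter>\<^bsub>cgraph_order\<^esub> H \<in> vertex_regular_graphs"
proof -
  let ?M = "G \<sqinter>\<^bsub>cgraph_order\<^esub> H"
  have c: "G \<in> coloured_graphs" "H \<in> coloured_graphs"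
    using G H by (simp_all add: vertex_regular_graphs_def)
  note M = cgraph_meet_greatest[OF c]
  have "equitable u (vclasses ?M)" if u: "u \<in> eclasses ?M" for u
  proof -
    have "vclasses ?M = vclasses G \<squnion>\<^bsub>partition_order UNIV\<^esub> vclasses H"
      by (simp add: cgraph_meet[OF c])
    then show ?thesis
      using equitable_join[OF _ vertex_regular_equitable_classes[OF G M(2) u]
          _ vertex_regular_equitable_classes[OF H M(3) u] finite] c
      by (simp add: coloured_graphs_iff)
  qed
  then show ?thesis using M(1) by (simp add: vertex_regular_graphs_def vertex_regular_def)
qed

text \<open>The complete graph with singleton colour classes works, since discrete partitions are
  trivially equitable. It supplies the greatest element needed for completeness.\<close>

lemma vertex_regular_graphs_top:
  obtains T :: "'v::finite cgraph" where "T \<in> vertex_regular_graphs"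
    and "\<And>G. G \<in> coloured_graphs \<Longrightarrow> cgraph_le G T"
proof
  define T :: "'v cgraph" where "T = (range (\<lambda>x. {x}), (\<lambda>e. {e}) ` {e. card e = 2})"
  have E: "edges T = {e. card e = 2}" by (auto simp: T_def edges_def)
  show "T \<in> vertex_regular_graphs"
    using partition_on_singletons[of UNIV] partition_on_singletons[of "{e :: 'v set. card e = 2}"]
    by (auto simp: vertex_regular_graphs_def coloured_graphs_iff E vertex_regular_def)
      (simp_all add: T_def equitable_singletons)
  fix G :: "'v cgraph" assume G: "G \<in> coloured_graphs"
  have "\<exists>U \<subseteq> eclasses T. u = \<Union> U" if "u \<in> eclasses G" for u
  proof (intro exI conjI)
    show "(\<lambda>e. {e}) ` u \<subseteq> eclasses T" using eclasses_card[OF G that] by (auto simp: T_def)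
  qed auto
  moreover have "refines UNIV (vclasses T) (vclasses G)"
  proof -
    have "partition_on UNIV (vclasses G)" using G by (simp add: coloured_graphs_iff)
    moreover from this have "\<exists>v \<in> vclasses G. x \<in> v" for x
      using partition_onD1 by fastforce
    ultimately show ?thesis
      using partition_on_singletons[of UNIV] by (auto simp: refines_def T_def)
  qed
  ultimately show "cgraph_le G T"
    using G by (auto simp: cgraph_le_def E coloured_graphs_iff)
qed

text \<open>An arbitrary order embedding \<open>F\<close> is used so that one argument covers both
  model types: bounds are computed among vertex regular graphs and carried over by
  \<open>F\<close>.\<close>

lemma inclusion_order_complete_lattice:
  fixes F :: "'v::finite cgraph \<Rightarrow> 'a set"
  assumes emb: "\<And>G H. G \<in> coloured_graphs \<Longrightarrow> H \<in> coloured_graphs \<Longrightarrow> F G \<subseteq> F H \<longleftrightarrow> cgraph_le G H"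
  defines "L \<equiv> inclusion_order (F ` vertex_regular_graphs)"
  shows "complete_lattice L"
    and "G \<in> vertex_regular_graphs \<Longrightarrow> H \<in> vertex_regular_graphs \<Longrightarrow>
      F G \<sqinter>\<^bsub>L\<^esub> F H = F (G \<sqinter>\<^bsub>cgraph_order\<^esub> H)"
    and "G \<in> vertex_regular_graphs \<Longrightarrow> H \<in> vertex_regular_graphs \<Longrightarrow>
      F G \<squnion>\<^bsub>L\<^esub> F H = F (s_P (G \<squnion>\<^bsub>cgraph_order\<^esub> H))"
proof -
  have L: "carrier L = F ` vertex_regular_graphs" "le L = (\<subseteq>)" "eq L = (=)"
    by (simp_all add: L_def inclusion_order_def)
  interpret partial_order L
    by unfold_locales (auto simp: L)
  have c: "G \<in> coloured_graphs" if "G \<in> vertex_regular_graphs" for G :: "'v cgraph"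
    using that by (simp add: vertex_regular_graphs_def)
  have meet: "greatest L (F (G \<sqinter>\<^bsub>cgraph_order\<^esub> H)) (Lower L {F G, F H})"
    if G: "G \<in> vertex_regular_graphs" and H: "H \<in> vertex_regular_graphs" for G H
  proof -
    note M = vertex_regular_meet[OF G H]
    note cM = cgraph_meet_greatest[OF c[OF G] c[OF H]]
    show ?thesis
    proof (rule greatest_LowerI)
      show "F (G \<sqinter>\<^bsub>cgraph_order\<^esub> H) \<sqsubseteq>\<^bsub>L\<^esub> x" if "x \<in> {F G, F H}" for x
        using that cM(2,3) G H by (elim insertE) (simp_all add: L emb c cM(1))
      show "x \<sqsubseteq>\<^bsub>L\<^esub> F (G \<sqinter>\<^bsub>cgraph_order\<^esub> H)" if x: "x \<in> Lower L {F G, F H}" for x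
      proof -
        obtain K where K: "K \<in> vertex_regular_graphs" "x = F K" using x unfolding Lower_def L(1) by blast
        have "F K \<subseteq> F G" "F K \<subseteq> F H"
          using Lower_memD[OF x, of "F G"] Lower_memD[OF x, of "F H"] G H K by (simp_all add: L)
        then show ?thesis using cM(4)[OF c[OF K(1)]] G H K by (simp add: L emb c cM(1))
      qed
    qed (use G H M in \<open>simp_all add: L\<close>)
  qed
  have join: "least L (F (s_P (G \<squnion>\<^bsub>cgraph_order\<^esub> H))) (Upper L {F G, F H})"
    if G: "G \<in> vertex_regular_graphs" and H: "H \<in> vertex_regular_graphs" for G H
  proof -
    let ?J = "G \<squnion>\<^bsub>cgraph_order\<^esub> H"
    note J = cgraph_join_least[OF c[OF G] c[OF H]]
    note S = s_P_least[OF J(1)]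
    have le: "cgraph_le G (s_P ?J)" "cgraph_le H (s_P ?J)"
      by (rule cgraph_le_trans[OF J(2) S(2)], rule cgraph_le_trans[OF J(3) S(2)])
    show ?thesis
    proof (rule least_UpperI)
      show "x \<sqsubseteq>\<^bsub>L\<^esub> F (s_P ?J)" if "x \<in> {F G, F H}" for x
        using that le G H by (elim insertE) (simp_all add: L emb c S(1))
      show "F (s_P ?J) \<sqsubseteq>\<^bsub>L\<^esub> x" if x: "x \<in> Upper L {F G, F H}" for x
      proof -
        obtain K where K: "K \<in> vertex_regular_graphs" "x = F K" using x unfolding Upper_def L(1) by blast
        have "F G \<subseteq> F K" "F H \<subseteq> F K"
          using Upper_memD[OF x, of "F G"] Upper_memD[OF x, of "F H"] G H K by (simp_all add: L)
        then have "cgraph_le ?J K" using J(4)[OF c[OF K(1)]] G H K by (simp add: emb c)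
        then show ?thesis using S(3)[OF K(1)] K S(1) by (simp add: L emb c)
      qed
    qed (use G H S(1) in \<open>simp_all add: L\<close>)
  qed
  \<comment> \<open>Binary infima give infima of nonempty finite sets. The carrier is finite, so
    together with the greatest element this yields completeness.\<close>
  interpret lower_semilattice L
  proof unfold_locales
    fix x y assume "x \<in> carrier L" "y \<in> carrier L"
    then obtain G H where "G \<in> vertex_regular_graphs" "H \<in> vertex_regular_graphs" "x = F G" "y = F H"
      unfolding L(1) by blast
    then show "\<exists>s. greatest L s (Lower L {x, y})" using meet by blast
  qed
  show "complete_lattice L"
  proof (rule complete_lattice_criterion1)
    obtain T :: "'v cgraph" where "T \<in> vertex_regular_graphs"
      "\<And>G. G \<in> coloured_graphs \<Longrightarrow> cgraph_le G T"
      using vertex_regular_graphs_top by blast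
    then have "greatest L (F T) (carrier L)" by (auto simp: greatest_def L emb c)
    then show "\<exists>g. greatest L g (carrier L)" ..
    fix A assume A: "A \<subseteq> carrier L" "A \<noteq> {}"
    have "finite A" using A(1) finite_subset by (fastforce simp: L)
    then have "greatest L (\<Sqinter>\<^bsub>L\<^esub>A) (Lower L A)" using A by (rule finite_inf_greatest)
    then show "\<exists>i. greatest L i (Lower L A)" ..
  qed
  \<comment> \<open>Meet and join are defined by choice; uniqueness of greatest and least elements
    pins them down.\<close>
  show "F G \<sqinter>\<^bsub>L\<^esub> F H = F (G \<sqinter>\<^bsub>cgraph_order\<^esub> H)"
    if "G \<in> vertex_regular_graphs" "H \<in> vertex_regular_graphs"
    unfolding meet_def[of L] inf_def[of L]
    by (rule some_equality) (use meet[OF that] greatest_unique in blast)+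
  show "F G \<squnion>\<^bsub>L\<^esub> F H = F (s_P (G \<squnion>\<^bsub>cgraph_order\<^esub> H))"
    if "G \<in> vertex_regular_graphs" "H \<in> vertex_regular_graphs"
    unfolding join_def[of L] sup_def[of L]
    by (rule some_equality) (use join[OF that] least_unique in blast)+
qed


section \<open>Models as level set conditions\<close>

text \<open>Common form of both models: \<open>\<psi>\<close> is the plain entry for
  \<open>RCON\<close> and \<open>scaled_entry\<close> for \<open>RCOR\<close>. The zero condition is
  also put on \<open>\<psi>\<close>, so that one partition of the labels carries all off-diagonal
  conditions.\<close>

definition colour_model ::
    "(real^'v^'v::finite \<Rightarrow> 'v \<Rightarrow> 'v \<Rightarrow> real) \<Rightarrow> 'v cgraph \<Rightarrow> (real^'v^'v) set"
  where "colour_model \<psi> G = {K \<in> spd_matrices.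
    (\<forall>\<alpha> \<beta>. \<alpha> \<noteq> \<beta> \<and> {\<alpha>, \<beta>} \<notin> edges G \<longrightarrow> \<psi> K \<alpha> \<beta> = 0) \<and>
    (\<forall>v \<in> vclasses G. \<forall>\<alpha> \<in> v. \<forall>\<beta> \<in> v. K $ \<alpha> $ \<alpha> = K $ \<beta> $ \<beta>) \<and>
    (\<forall>u \<in> eclasses G. \<forall>\<alpha> \<beta> \<gamma> \<delta>. {\<alpha>, \<beta>} \<in> u \<and> {\<gamma>, \<delta>} \<in> u \<longrightarrow> \<psi> K \<alpha> \<beta> = \<psi> K \<gamma> \<delta>)}"

text \<open>For symmetric \<open>\<psi> K\<close> this is \<open>\<psi> K \<alpha> \<beta>\<close> at the edge \<open>{\<alpha>, \<beta>}\<close>, and \<open>0\<close> at the label \<open>{}\<close>.\<close>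

definition edge_value ::
    "(real^'v^'v::finite \<Rightarrow> 'v \<Rightarrow> 'v \<Rightarrow> real) \<Rightarrow> real^'v^'v \<Rightarrow> 'v set \<Rightarrow> real"
  where "edge_value \<psi> K e = (\<Sum>\<alpha>\<in>e. \<Sum>\<beta>\<in>e - {\<alpha>}. \<psi> K \<alpha> \<beta>) / 2"

text \<open>Both ordered pairs contribute the same amount, hence the division by 2 in
  \<open>edge_value\<close>.\<close>

lemma edge_value_pair:
  assumes "\<alpha> \<noteq> \<beta>" "\<psi> K \<beta> \<alpha> = \<psi> K \<alpha> \<beta>"
  shows "edge_value \<psi> K {\<alpha>, \<beta>} = \<psi> K \<alpha> \<beta>"
proof -
  have "{\<alpha>, \<beta>} - {\<alpha>} = {\<beta>}" "{\<alpha>, \<beta>} - {\<beta>} = {\<alpha>}" using assms(1) by auto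
  then show ?thesis using assms by (simp add: edge_value_def)
qed

text \<open>Since \<open>edge_value\<close> is 0 at \<open>{}\<close>, constancy on the zero class
  forces the zeros of the model; constancy on the other classes is the equality condition on edges.
  \<open>refines_level_sets_iff\<close> turns constancy into refinement.\<close>

lemma mem_colour_model_iff:
  assumes G: "G \<in> coloured_graphs"
    and sym: "\<forall>K \<in> spd_matrices. \<forall>\<alpha> \<beta>. \<psi> K \<beta> \<alpha> = \<psi> K \<alpha> \<beta>"
  shows "K \<in> colour_model \<psi> G \<longleftrightarrow> K \<in> spd_matrices \<and>
    refines UNIV (vclasses G) (level_sets UNIV (\<lambda>\<alpha>. K $ \<alpha> $ \<alpha>)) \<and>
    refines edge_labels (zero_partition G) (level_sets edge_labels (edge_value \<psi> K))"
proof (cases "K \<in> spd_matrices")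
  case True
  have val: "edge_value \<psi> K {\<alpha>, \<beta>} = \<psi> K \<alpha> \<beta>" if "card {\<alpha>, \<beta>} = 2" for \<alpha> \<beta>
  proof -
    have "\<alpha> \<noteq> \<beta>" using that by auto
    then show ?thesis using sym True by (simp add: edge_value_pair)
  qed
  have pair: "\<exists>\<alpha> \<beta>. e = {\<alpha>, \<beta>} \<and> \<alpha> \<noteq> \<beta>" if "card e = 2" for e :: "'a set"
    using that by (auto simp: card_2_iff)
  have zero: "edge_value \<psi> K {} = 0" by (simp add: edge_value_def)
  let ?z = "insert {} ({e. card e = 2} - edges G)"
  have z: "(\<forall>x \<in> ?z. \<forall>y \<in> ?z. edge_value \<psi> K x = edge_value \<psi> K y) \<longleftrightarrow>
    (\<forall>\<alpha> \<beta>. \<alpha> \<noteq> \<beta> \<and> {\<alpha>, \<beta>} \<notin> edges G \<longrightarrow> \<psi> K \<alpha> \<beta> = 0)" (is "?l \<longleftrightarrow> ?r")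
  proof
    assume l: ?l
    show ?r
    proof (intro allI impI)
      fix \<alpha> \<beta> assume ab: "\<alpha> \<noteq> \<beta> \<and> {\<alpha>, \<beta>} \<notin> edges G"
      then have "{\<alpha>, \<beta>} \<in> ?z" by simp
      then have "edge_value \<psi> K {\<alpha>, \<beta>} = edge_value \<psi> K {}" using l by blast
      then show "\<psi> K \<alpha> \<beta> = 0" using ab val zero by simp
    qed
  next
    assume r: ?r
    have "edge_value \<psi> K e = 0" if "e \<in> ?z" for e
    proof (cases "e = {}")
      case False
      then have e: "card e = 2" "e \<notin> edges G" using that by auto
      obtain \<alpha> \<beta> where "e = {\<alpha>, \<beta>}" "\<alpha> \<noteq> \<beta>" using pair[OF e(1)] by blast
      moreover from this have "\<psi> K \<alpha> \<beta> = 0" using r e(2) by simp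
      ultimately show ?thesis using val[of \<alpha> \<beta>] e(1) by simp
    qed (simp add: zero)
    then show ?l by simp
  qed
  have u: "(\<forall>x \<in> u. \<forall>y \<in> u. edge_value \<psi> K x = edge_value \<psi> K y) \<longleftrightarrow>
    (\<forall>\<alpha> \<beta> \<gamma> \<delta>. {\<alpha>, \<beta>} \<in> u \<and> {\<gamma>, \<delta>} \<in> u \<longrightarrow> \<psi> K \<alpha> \<beta> = \<psi> K \<gamma> \<delta>)" (is "?l \<longleftrightarrow> ?r")
    if u: "u \<in> eclasses G" for u
  proof
    assume l: ?l
    show ?r
    proof (intro allI impI)
      fix \<alpha> \<beta> \<gamma> \<delta> assume m: "{\<alpha>, \<beta>} \<in> u \<and> {\<gamma>, \<delta>} \<in> u"
      then have "edge_value \<psi> K {\<alpha>, \<beta>} = edge_value \<psi> K {\<gamma>, \<delta>}" using l by blast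
      then show "\<psi> K \<alpha> \<beta> = \<psi> K \<gamma> \<delta>" using m val eclasses_card[OF G u] by simp
    qed
  next
    assume r: ?r
    show ?l
    proof (intro ballI)
      fix e f assume ef: "e \<in> u" "f \<in> u"
      obtain \<alpha> \<beta> where e: "e = {\<alpha>, \<beta>}" "\<alpha> \<noteq> \<beta>" using pair eclasses_card[OF G u ef(1)] by blast
      obtain \<gamma> \<delta> where f: "f = {\<gamma>, \<delta>}" "\<gamma> \<noteq> \<delta>" using pair eclasses_card[OF G u ef(2)] by blast
      have "\<psi> K \<alpha> \<beta> = \<psi> K \<gamma> \<delta>" using r ef e f by blast
      then show "edge_value \<psi> K e = edge_value \<psi> K f" using val e f by simp
    qed
  qed
  have "partition_on UNIV (vclasses G)" using G by (simp add: coloured_graphs_iff)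
  note V = refines_level_sets_iff[OF this] and E = refines_level_sets_iff[OF partition_on_zero_partition[OF G]]
  have ball: "(\<forall>p \<in> zero_partition G. Q p) \<longleftrightarrow> Q ?z \<and> (\<forall>u \<in> eclasses G. Q u)" for Q
    by (simp add: zero_partition_def)
  have E': "(\<forall>p \<in> zero_partition G. \<forall>x \<in> p. \<forall>y \<in> p. edge_value \<psi> K x = edge_value \<psi> K y) \<longleftrightarrow>
    (\<forall>\<alpha> \<beta>. \<alpha> \<noteq> \<beta> \<and> {\<alpha>, \<beta>} \<notin> edges G \<longrightarrow> \<psi> K \<alpha> \<beta> = 0) \<and>
    (\<forall>u \<in> eclasses G. \<forall>\<alpha> \<beta> \<gamma> \<delta>. {\<alpha>, \<beta>} \<in> u \<and> {\<gamma>, \<delta>} \<in> u \<longrightarrow> \<psi> K \<alpha> \<beta> = \<psi> K \<gamma> \<delta>)"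
    unfolding ball z by (rule arg_cong[OF ball_cong[OF refl u]])
  show ?thesis unfolding V E E' colour_model_def mem_Collect_eq by (simp only: conj_ac)
qed (simp add: colour_model_def)

text \<open>The embedding property only needs one matrix in the model of \<open>G\<close> whose diagonal and edge
  values distinguish all classes.\<close>

lemma colour_model_subset_iff:
  fixes G H :: "'v::finite cgraph"
  assumes G: "G \<in> coloured_graphs" and H: "H \<in> coloured_graphs"
    and sym: "\<forall>K \<in> spd_matrices. \<forall>\<alpha> \<beta>. \<psi> K \<beta> \<alpha> = \<psi> K \<alpha> \<beta>"
    and "\<epsilon> > 0"
    and realize: "\<And>d f. (\<And>\<alpha>. 1 \<le> d \<alpha> \<and> d \<alpha> \<le> 3) \<Longrightarrow> (\<And>e. \<bar>f e\<bar> \<le> \<epsilon>) \<Longrightarrow>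
      \<exists>K \<in> spd_matrices. (\<forall>\<alpha>. K $ \<alpha> $ \<alpha> = d \<alpha>) \<and> (\<forall>\<alpha> \<beta>. \<alpha> \<noteq> \<beta> \<longrightarrow> \<psi> K \<alpha> \<beta> = f {\<alpha>, \<beta>})"
  shows "colour_model \<psi> G \<subseteq> colour_model \<psi> H \<longleftrightarrow> cgraph_le G H"
proof
  assume le: "cgraph_le G H"
  show "colour_model \<psi> G \<subseteq> colour_model \<psi> H"
  proof
    fix K assume "K \<in> colour_model \<psi> G"
    then show "K \<in> colour_model \<psi> H"
      using le
      unfolding cgraph_le_iff_refines[OF G H] mem_colour_model_iff[OF G sym]
        mem_colour_model_iff[OF H sym]
      by (elim conjE) (simp add: refines_trans[of _ "vclasses H" "vclasses G"]
        refines_trans[of _ "zero_partition H" "zero_partition G"])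
  qed
next
  assume sub: "colour_model \<psi> G \<subseteq> colour_model \<psi> H"
  have vG: "partition_on UNIV (vclasses G)" using G by (simp add: coloured_graphs_iff)
  \<comment> \<open>Shifting by 2 will bring the diagonal into the interval from 1 to 3; the point
    where \<open>d\<close> is made to vanish is arbitrary.\<close>
  obtain d :: "'v \<Rightarrow> real" where d: "level_sets UNIV d = vclasses G" "\<And>\<alpha>. \<bar>d \<alpha>\<bar> \<le> 1"
    by (rule partition_as_level_sets[OF vG, of undefined 1]) auto
  \<comment> \<open>Normalised to 0 at \<open>{}\<close>, so that all non-edges of \<open>G\<close>
    receive value 0.\<close>
  obtain f :: "'v set \<Rightarrow> real" where f: "level_sets edge_labels f = zero_partition G" "f {} = 0"
      "\<And>e. \<bar>f e\<bar> \<le> \<epsilon>"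
    by (rule partition_as_level_sets[OF partition_on_zero_partition[OF G], of "{}" \<epsilon>])
      (use \<open>\<epsilon> > 0\<close> in auto)
  have "1 \<le> 2 + d \<alpha> \<and> 2 + d \<alpha> \<le> 3" for \<alpha> using d(2)[of \<alpha>] by auto
  then obtain K where K: "K \<in> spd_matrices" "\<And>\<alpha>. K $ \<alpha> $ \<alpha> = 2 + d \<alpha>"
    "\<And>\<alpha> \<beta>. \<alpha> \<noteq> \<beta> \<Longrightarrow> \<psi> K \<alpha> \<beta> = f {\<alpha>, \<beta>}"
    using realize[of "\<lambda>\<alpha>. 2 + d \<alpha>" f] f(3) by blast
  have V: "level_sets UNIV (\<lambda>\<alpha>. K $ \<alpha> $ \<alpha>) = vclasses G"
    using d(1) by (simp add: level_sets_def K(2))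
  have val: "edge_value \<psi> K e = f e" if "e \<in> edge_labels" for e
  proof (cases "e = {}")
    case False
    then have "card e = 2" using that by simp
    then obtain \<alpha> \<beta> where e: "e = {\<alpha>, \<beta>}" "\<alpha> \<noteq> \<beta>" by (auto simp: card_2_iff)
    then show ?thesis using edge_value_pair[OF e(2)] sym K(1,3) by simp
  qed (simp add: edge_value_def f(2))
  have E: "level_sets edge_labels (edge_value \<psi> K) = zero_partition G"
    unfolding f(1)[symmetric] level_sets_def
  proof (rule image_cong[OF refl])
    fix e :: "'v set" assume "e \<in> edge_labels"
    then show "{y \<in> edge_labels. edge_value \<psi> K y = edge_value \<psi> K e} = {y \<in> edge_labels. f y = f e}"
      using val by (intro Collect_cong conj_cong refl) simp
  qed
  have "K \<in> colour_model \<psi> G"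
    unfolding mem_colour_model_iff[OF G sym] V E
    using K(1) vG partition_on_zero_partition[OF G] by (simp add: refines_refl)
  \<comment> \<open>The level sets of \<open>K\<close> are exactly the classes of \<open>G\<close>,
    so membership in the model of \<open>H\<close> is the order relation.\<close>
  then have "K \<in> colour_model \<psi> H" using sub by blast
  then show "cgraph_le G H"
    unfolding mem_colour_model_iff[OF H sym] cgraph_le_iff_refines[OF G H] V E by simp
qed

section \<open>Positive definite matrices with prescribed entries\<close>

lemma spd_matrices_diagonal_pos:
  assumes "K \<in> spd_matrices"
  shows "K $ \<alpha> $ \<alpha> > 0"
proof -
  have "axis \<alpha> (1::real) \<noteq> 0" by simp
  then have "axis \<alpha> 1 \<bullet> (K *v axis \<alpha> 1) > 0" using assms by (simp add: spd_matrices_def)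
  then show ?thesis by (simp add: inner_axis' matrix_vector_mul_component inner_axis)
qed

lemma spd_matrices_sym: "K \<in> spd_matrices \<Longrightarrow> K $ \<beta> $ \<alpha> = K $ \<alpha> $ \<beta>"
  by (simp add: spd_matrices_def) (metis transpose_def vec_lambda_beta)

text \<open>Bounding the absolute value of a product by half the sum of the squares controls the
  off-diagonal terms; summing over all pairs leaves at least \<open>1 - \<eta> * CARD('v)\<close>
  times the squared norm of \<open>x\<close>.\<close>

lemma diagonally_dominant_spd:
  fixes K :: "real^'v^'v::finite"
  assumes sym: "\<And>\<alpha> \<beta>. K $ \<beta> $ \<alpha> = K $ \<alpha> $ \<beta>" and diag: "\<And>\<alpha>. K $ \<alpha> $ \<alpha> \<ge> 1"
    and off: "\<And>\<alpha> \<beta>. \<alpha> \<noteq> \<beta> \<Longrightarrow> \<bar>K $ \<alpha> $ \<beta>\<bar> \<le> \<delta>" and \<delta>: "\<delta> * CARD('v) < 1"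
  shows "K \<in> spd_matrices"
proof -
  have pos: "x \<bullet> (K *v x) > 0" if "x \<noteq> 0" for x
  proof -
    \<comment> \<open>With a single vertex \<open>off\<close> is vacuous and \<open>\<delta>\<close>
      may be negative, hence the maximum.\<close>
    define \<eta> where "\<eta> = max 0 \<delta>"
    have \<eta>: "\<eta> \<ge> 0" "\<eta> * CARD('v) < 1"
      using \<delta> by (simp_all add: \<eta>_def max_def)
    have off_\<eta>: "\<bar>K $ \<alpha> $ \<beta>\<bar> \<le> \<eta>" if "\<alpha> \<noteq> \<beta>" for \<alpha> \<beta>
      using off[OF that] by (simp add: \<eta>_def)
    \<comment> \<open>The diagonal terms also give up \<open>\<eta>\<close> times the square, so
      that the subtracted part has the same shape for all pairs.\<close>
    have entry: "x $ \<alpha> * K $ \<alpha> $ \<beta> * x $ \<beta> \<ge>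
        (if \<alpha> = \<beta> then (x $ \<alpha>)\<^sup>2 else 0) - \<eta> * ((x $ \<alpha>)\<^sup>2 + (x $ \<beta>)\<^sup>2) / 2" for \<alpha> \<beta>
    proof (cases "\<alpha> = \<beta>")
      case True
      have "1 * (x $ \<alpha>)\<^sup>2 \<le> K $ \<alpha> $ \<alpha> * (x $ \<alpha>)\<^sup>2" using diag by (intro mult_right_mono) auto
      moreover have "0 \<le> \<eta> * (x $ \<alpha>)\<^sup>2" using \<eta>(1) by simp
      ultimately show ?thesis using True by (simp add: power2_eq_square algebra_simps)
    next
      case False
      have "\<bar>x $ \<alpha> * x $ \<beta>\<bar> \<le> ((x $ \<alpha>)\<^sup>2 + (x $ \<beta>)\<^sup>2) / 2"
        using sum_squares_bound[of "x $ \<alpha>" "x $ \<beta>"] sum_squares_bound[of "x $ \<alpha>" "- x $ \<beta>"]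
        by (simp add: abs_if)
      then have "\<bar>K $ \<alpha> $ \<beta>\<bar> * \<bar>x $ \<alpha> * x $ \<beta>\<bar> \<le> \<eta> * (((x $ \<alpha>)\<^sup>2 + (x $ \<beta>)\<^sup>2) / 2)"
        using \<eta>(1) off_\<eta>[OF False] by (intro mult_mono) auto
      then have "\<bar>x $ \<alpha> * K $ \<alpha> $ \<beta> * x $ \<beta>\<bar> \<le> \<eta> * ((x $ \<alpha>)\<^sup>2 + (x $ \<beta>)\<^sup>2) / 2"
        by (simp add: abs_mult mult_ac)
      then show ?thesis using False by simp
    qed
    have norm: "(\<Sum>\<alpha>\<in>UNIV. (x $ \<alpha>)\<^sup>2) = x \<bullet> x"
      by (simp add: inner_vec_def power2_eq_square)
    have "x \<bullet> x > 0" using that by simp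
    then have "0 < (1 - \<eta> * CARD('v)) * (x \<bullet> x)" using \<eta>(2) by simp
    also have "\<dots> = (\<Sum>\<alpha>\<in>UNIV. \<Sum>\<beta>\<in>UNIV.
        (if \<alpha> = \<beta> then (x $ \<alpha>)\<^sup>2 else 0) - \<eta> * ((x $ \<alpha>)\<^sup>2 + (x $ \<beta>)\<^sup>2) / 2)"
      by (simp add: sum_subtractf sum.distrib norm[symmetric] algebra_simps
          sum_divide_distrib[symmetric] sum_distrib_left[symmetric])
    also have "\<dots> \<le> (\<Sum>\<alpha>\<in>UNIV. \<Sum>\<beta>\<in>UNIV. x $ \<alpha> * K $ \<alpha> $ \<beta> * x $ \<beta>)"
      by (intro sum_mono entry)
    also have "\<dots> = x \<bullet> (K *v x)"
      by (simp add: inner_vec_def matrix_vector_mult_def sum_distrib_left mult_ac)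
    finally show ?thesis .
  qed
  have "transpose K = K" by (simp add: transpose_def vec_eq_iff sym)
  then show ?thesis using pos by (simp add: spd_matrices_def)
qed

section \<open>Both model types as order embeddings\<close>

lemma RCON_subset_iff:
  fixes G H :: "'v::finite cgraph"
  assumes "G \<in> coloured_graphs" "H \<in> coloured_graphs"
  shows "RCON G \<subseteq> RCON H \<longleftrightarrow> cgraph_le G H"
proof -
  let ?\<psi> = "\<lambda>K :: real^'v^'v. \<lambda>\<alpha> \<beta>. K $ \<alpha> $ \<beta>"
  have "colour_model ?\<psi> G \<subseteq> colour_model ?\<psi> H \<longleftrightarrow> cgraph_le G H"
  proof (rule colour_model_subset_iff[OF assms])
    show "\<forall>K \<in> spd_matrices :: (real^'v^'v) set. \<forall>\<alpha> \<beta>. K $ \<beta> $ \<alpha> = K $ \<alpha> $ \<beta>"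
      using spd_matrices_sym by blast
    \<comment> \<open>This bound makes \<open>\<delta> * CARD('v)\<close> equal to 1/2 in
      \<open>diagonally_dominant_spd\<close>.\<close>
    show "0 < 1 / (2 * real CARD('v))" by simp
    fix d :: "'v \<Rightarrow> real" and f :: "'v set \<Rightarrow> real"
    assume d: "\<And>\<alpha>. 1 \<le> d \<alpha> \<and> d \<alpha> \<le> 3" and f: "\<And>e. \<bar>f e\<bar> \<le> 1 / (2 * real CARD('v))"
    let ?K = "(\<chi> \<alpha> \<beta>. if \<alpha> = \<beta> then d \<alpha> else f {\<alpha>, \<beta>}) :: real^'v^'v"
    have "?K \<in> spd_matrices"
      by (rule diagonally_dominant_spd[of _ "1 / (2 * real CARD('v))"])
        (use d f in \<open>auto simp: insert_commute\<close>)
    then show "\<exists>K \<in> spd_matrices. (\<forall>\<alpha>. K $ \<alpha> $ \<alpha> = d \<alpha>) \<and>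
        (\<forall>\<alpha> \<beta>. \<alpha> \<noteq> \<beta> \<longrightarrow> K $ \<alpha> $ \<beta> = f {\<alpha>, \<beta>})"
      by (rule bexI[rotated]) simp
  qed
  then show ?thesis by (simp add: colour_model_def RCON_def)
qed

lemma RCOR_subset_iff:
  fixes G H :: "'v::finite cgraph"
  assumes "G \<in> coloured_graphs" "H \<in> coloured_graphs"
  shows "RCOR G \<subseteq> RCOR H \<longleftrightarrow> cgraph_le G H"
proof -
  have "colour_model scaled_entry G \<subseteq> colour_model scaled_entry H \<longleftrightarrow> cgraph_le G H"
  proof (rule colour_model_subset_iff[OF assms])
    have "scaled_entry K \<beta> \<alpha> = scaled_entry K \<alpha> \<beta>" if "K \<in> spd_matrices" for K :: "real^'v^'v" and \<alpha> \<beta>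
      using spd_matrices_sym[OF that, of \<beta> \<alpha>] by (simp add: scaled_entry_def mult.commute)
    then show "\<forall>K \<in> spd_matrices :: (real^'v^'v) set. \<forall>\<alpha> \<beta>. scaled_entry K \<beta> \<alpha> = scaled_entry K \<alpha> \<beta>"
      by blast
    \<comment> \<open>Geometric means of diagonal entries are at most 3, so a third of the bound for
      \<open>RCON\<close> keeps the unscaled entries small enough.\<close>
    show "0 < 1 / (6 * real CARD('v))" by simp
    fix d :: "'v \<Rightarrow> real" and f :: "'v set \<Rightarrow> real"
    assume d: "\<And>\<alpha>. 1 \<le> d \<alpha> \<and> d \<alpha> \<le> 3" and f: "\<And>e. \<bar>f e\<bar> \<le> 1 / (6 * real CARD('v))"
    \<comment> \<open>Multiplying by the geometric mean of the diagonal entries undoes the scaling,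
      so \<open>f\<close> prescribes the scaled entries.\<close>
    let ?K = "(\<chi> \<alpha> \<beta>. if \<alpha> = \<beta> then d \<alpha> else sqrt (d \<alpha> * d \<beta>) * f {\<alpha>, \<beta>}) :: real^'v^'v"
    have pos: "0 < d \<alpha> * d \<beta>" for \<alpha> \<beta> using d[of \<alpha>] d[of \<beta>] by simp
    have "d \<alpha> * d \<beta> \<le> 3 * 3" for \<alpha> \<beta> using d[of \<alpha>] d[of \<beta>] by (intro mult_mono) auto
    then have sq: "sqrt (d \<alpha> * d \<beta>) \<le> 3" for \<alpha> \<beta>
      by (intro real_le_lsqrt) (simp_all add: power2_eq_square)
    have bound: "\<bar>sqrt (d \<alpha> * d \<beta>) * f e\<bar> \<le> 1 / (2 * real CARD('v))" for \<alpha> \<beta> e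
    proof -
      have "\<bar>sqrt (d \<alpha> * d \<beta>)\<bar> * \<bar>f e\<bar> \<le> 3 * (1 / (6 * real CARD('v)))"
        using pos[of \<alpha> \<beta>] sq f by (intro mult_mono) auto
      then show ?thesis by (simp add: abs_mult)
    qed
    have "?K \<in> spd_matrices"
    proof (rule diagonally_dominant_spd)
      show "?K $ \<beta> $ \<alpha> = ?K $ \<alpha> $ \<beta>" for \<alpha> \<beta> by (simp add: insert_commute mult.commute)
      show "1 \<le> ?K $ \<alpha> $ \<alpha>" for \<alpha> using d by simp
      show "\<bar>?K $ \<alpha> $ \<beta>\<bar> \<le> 1 / (2 * real CARD('v))" if "\<alpha> \<noteq> \<beta>" for \<alpha> \<beta> using that bound by simp
    qed simp
    moreover have "scaled_entry ?K \<alpha> \<beta> = f {\<alpha>, \<beta>}" if "\<alpha> \<noteq> \<beta>" for \<alpha> \<beta>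
      using that pos[of \<alpha> \<beta>] by (auto simp: scaled_entry_def)
    ultimately show "\<exists>K \<in> spd_matrices. (\<forall>\<alpha>. K $ \<alpha> $ \<alpha> = d \<alpha>) \<and>
        (\<forall>\<alpha> \<beta>. \<alpha> \<noteq> \<beta> \<longrightarrow> scaled_entry K \<alpha> \<beta> = f {\<alpha>, \<beta>})"
      by (intro bexI[of _ ?K]) auto
  qed
  \<comment> \<open>The diagonal is positive, so scaled and plain entries have the same zeros; hence
    \<open>colour_model scaled_entry\<close> agrees with \<open>RCOR\<close>.\<close>
  moreover have "scaled_entry K \<alpha> \<beta> = 0 \<longleftrightarrow> K $ \<alpha> $ \<beta> = 0" if "K \<in> spd_matrices" for K :: "real^'v^'v" and \<alpha> \<beta>
    using spd_matrices_diagonal_pos[OF that] by (auto simp: scaled_entry_def less_imp_neq[symmetric])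
  then have "colour_model scaled_entry X = RCOR X" for X :: "'v cgraph"
    by (auto simp: colour_model_def RCOR_def)
  ultimately show ?thesis by simp
qed

theorem theorem5p19:
  shows "complete_lattice (RCON_order :: (real^'v^'v::finite) set gorder) \<and>
    complete_lattice (RCOR_order :: (real^'v^'v) set gorder) \<and>
    (\<forall>G \<in> vertex_regular_graphs :: 'v cgraph set. \<forall>H \<in> vertex_regular_graphs.
       G \<sqinter>\<^bsub>cgraph_order\<^esub> H \<in> vertex_regular_graphs \<and>
       RCON G \<sqinter>\<^bsub>RCON_order\<^esub> RCON H = RCON (G \<sqinter>\<^bsub>cgraph_order\<^esub> H) \<and>
       RCOR G \<sqinter>\<^bsub>RCOR_order\<^esub> RCOR H = RCOR (G \<sqinter>\<^bsub>cgraph_order\<^esub> H) \<and>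
       RCON G \<squnion>\<^bsub>RCON_order\<^esub> RCON H = RCON (s_P (G \<squnion>\<^bsub>cgraph_order\<^esub> H)) \<and>
       RCOR G \<squnion>\<^bsub>RCOR_order\<^esub> RCOR H = RCOR (s_P (G \<squnion>\<^bsub>cgraph_order\<^esub> H)))"
  unfolding RCON_order_def RCOR_order_def
  by (intro conjI ballI vertex_regular_meet
      inclusion_order_complete_lattice[of RCON, OF RCON_subset_iff]
      inclusion_order_complete_lattice[of RCOR, OF RCOR_subset_iff])

end
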